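(* Let $G_1,\dots,G_n$ be rooted graphs and let $G$ be the decorated path obtained from them, with path vertices $1,\dots,n$. Assume $\alpha_1^G=\alpha_n^G$. Then vertices $1$ and $n$ are strongly cospectral in $G$ if and only if, for every eigenvalue $\theta$ in the eigenvalue support of vertex $1$ (equivalently, of vertex $n$) and every $k\in\{1,\dots,n\}$, $\theta$ is not a pole of $\alpha_k^{G_k}$.
   Context: Graphs are finite and simple. For a graph $H$, $\phi^H$ is the characteristic polynomial of its adjacency matrix $A(H)$, and for a vertex $i$, $\alpha_i^H=\phi^H/\phi^{H\setminus i}$ (rational function in $x$). For an eigenvalue $\theta$ of $A(H)$ let $E_\theta$ be the orthogonal projection onto its eigenspace, and $e_i$ the standard basis vector of vertex $i$. The eigenvalue support of vertex $i$ is the set of eigenvalues $\theta$ with $E_\theta e_i\neq 0$ (equivalently, some $\theta$-eigenvector has a non-zero entry at $i$). Vertices $i,j$ are strongly cospectral if $E_\theta e_i=\pm E_\theta e_j$ for every eigenvalue $\theta$. A rooted graph is a graph with a distinguished root. The decorated path built from pairwise disjoint rooted graphs $G_1,\dots,G_n$ is obtained from the path on vertices $1,\dots,n$ ($i\sim i+1$) by identifying the root of $G_i$ with vertex $i$; $\alpha_i^{G_i}$ is taken at this root. *)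

theory Defs
  imports "Jordan_Normal_Form.Char_Poly" "HOL-Computational_Algebra.Fraction_Field"
begin

definition simple_graph :: "nat \<Rightarrow> (nat \<Rightarrow> nat \<Rightarrow> bool) \<Rightarrow> bool" where
  "simple_graph m E \<longleftrightarrow> (\<forall>i<m. \<forall>j<m. E i j = E j i) \<and> (\<forall>i<m. \<not> E i i)"

definition adj_mat :: "nat \<Rightarrow> (nat \<Rightarrow> nat \<Rightarrow> bool) \<Rightarrow> real mat" where
  "adj_mat m E = mat m m (\<lambda>(i,j). if E i j then 1 else 0)"

definition phi :: "real mat \<Rightarrow> real poly" where
  "phi A = char_poly A"

definition phi_del :: "real mat \<Rightarrow> nat \<Rightarrow> real poly" where
  "phi_del A i = char_poly (mat_delete A i i)"

definition alpha :: "real mat \<Rightarrow> nat \<Rightarrow> real poly fract" where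
  "alpha A i = Fract (phi A) (phi_del A i)"

(* the rational function p/q (q \<noteq> 0) has a pole at theta iff, after cancelling common
   factors, the denominator vanishes at theta, i.e. ord_theta q > ord_theta p *)
definition rat_pole :: "real poly \<Rightarrow> real poly \<Rightarrow> real \<Rightarrow> bool" where
  "rat_pole p q \<theta> \<longleftrightarrow> q \<noteq> 0 \<and> order \<theta> q > order \<theta> p"

definition alpha_pole :: "real mat \<Rightarrow> nat \<Rightarrow> real \<Rightarrow> bool" where
  "alpha_pole A i \<theta> \<longleftrightarrow> rat_pole (phi A) (phi_del A i) \<theta>"

definition eigenspace :: "real mat \<Rightarrow> real \<Rightarrow> real vec set" where
  "eigenspace A \<theta> = {v \<in> carrier_vec (dim_row A). A *\<^sub>v v = \<theta> \<cdot>\<^sub>v v}"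

definition eig_proj :: "real mat \<Rightarrow> real \<Rightarrow> real vec \<Rightarrow> real vec" where
  "eig_proj A \<theta> x = (THE v. v \<in> eigenspace A \<theta> \<and>
      (\<forall>w \<in> eigenspace A \<theta>. (x - v) \<bullet> w = 0))"

definition eig_support :: "real mat \<Rightarrow> nat \<Rightarrow> real set" where
  "eig_support A i = {\<theta>. eigenvalue A \<theta> \<and>
      eig_proj A \<theta> (unit_vec (dim_row A) i) \<noteq> 0\<^sub>v (dim_row A)}"

definition strongly_cospectral :: "real mat \<Rightarrow> nat \<Rightarrow> nat \<Rightarrow> bool" where
  "strongly_cospectral A i j \<longleftrightarrow> (\<forall>\<theta>. eigenvalue A \<theta> \<longrightarrow>
      (eig_proj A \<theta> (unit_vec (dim_row A) i) = eig_proj A \<theta> (unit_vec (dim_row A) j) \<or>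
       eig_proj A \<theta> (unit_vec (dim_row A) i) = - eig_proj A \<theta> (unit_vec (dim_row A) j)))"

(* rooted graph: (number of vertices m, adjacency E on {0..<m}, root r) *)
type_synonym rgraph = "nat \<times> (nat \<Rightarrow> nat \<Rightarrow> bool) \<times> nat"

definition rg_size :: "rgraph \<Rightarrow> nat" where "rg_size G = fst G"
definition rg_adj :: "rgraph \<Rightarrow> nat \<Rightarrow> nat \<Rightarrow> bool" where "rg_adj G = fst (snd G)"
definition rg_root :: "rgraph \<Rightarrow> nat" where "rg_root G = snd (snd G)"

definition rooted_graph :: "rgraph \<Rightarrow> bool" where
  "rooted_graph G \<longleftrightarrow> simple_graph (rg_size G) (rg_adj G) \<and> rg_root G < rg_size G"

definition rg_mat :: "rgraph \<Rightarrow> real mat" where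
  "rg_mat G = adj_mat (rg_size G) (rg_adj G)"

(* Decorated path from Gs = [G_1,...,G_n] (list index k-1 for G_k).
   G_k occupies the vertex block [offs Gs (k-1), offs Gs k); its root is path vertex k. *)
definition offs :: "rgraph list \<Rightarrow> nat \<Rightarrow> nat" where
  "offs Gs k = (\<Sum>l<k. rg_size (Gs ! l))"

definition dp_size :: "rgraph list \<Rightarrow> nat" where
  "dp_size Gs = offs Gs (length Gs)"

(* vertex of the decorated path corresponding to path vertex k+1 (0-based list index k) *)
definition dp_vertex :: "rgraph list \<Rightarrow> nat \<Rightarrow> nat" where
  "dp_vertex Gs k = offs Gs k + rg_root (Gs ! k)"

definition dp_adj :: "rgraph list \<Rightarrow> nat \<Rightarrow> nat \<Rightarrow> bool" where
  "dp_adj Gs a b \<longleftrightarrow>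
     (\<exists>k<length Gs. offs Gs k \<le> a \<and> a < offs Gs (Suc k) \<and> offs Gs k \<le> b \<and> b < offs Gs (Suc k)
        \<and> rg_adj (Gs ! k) (a - offs Gs k) (b - offs Gs k))
   \<or> (\<exists>k. Suc k < length Gs \<and> {a, b} = {dp_vertex Gs k, dp_vertex Gs (Suc k)})"

definition dp_mat :: "rgraph list \<Rightarrow> real mat" where
  "dp_mat Gs = adj_mat (dp_size Gs) (dp_adj Gs)"

end

theory Submission
  imports Defs
begin

text \<open>
  By the spectral theorem, \<open>\<phi>(H - i) / \<phi>(H)\<close> is the sum of \<open>|E\<^sub>\<mu> e\<^sub>i|\<^sup>2 / (x - \<mu>)\<close> over the
  eigenvalues \<open>\<mu>\<close>. Hence \<open>\<alpha>\<^sub>i = \<alpha>\<^sub>j\<close> means \<open>|E\<^sub>\<mu> e\<^sub>i| = |E\<^sub>\<mu> e\<^sub>j|\<close> for all \<open>\<mu>\<close>, and \<open>\<theta>\<close> is a pole of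
  \<open>\<alpha>\<^sub>i\<close> iff \<open>(A - \<theta>) w = e\<^sub>i\<close> has a solution \<open>w\<close> with \<open>w\<^sub>i = 0\<close>.

  Let \<open>v\<close> be a \<open>\<theta>\<close>-eigenvector of the decorated path. If no \<open>G\<^sub>k\<close> has a pole at \<open>\<theta>\<close> and \<open>v\<close> vanishes
  at path vertex \<open>1\<close>, then going along the path it vanishes at all path vertices: at the first
  exception \<open>k + 1\<close>, the restriction of \<open>v\<close> to \<open>G\<^sub>k\<close> would be a multiple of such a \<open>w\<close>. So
  \<open>E\<^sub>\<theta> e\<^sub>1\<close> and \<open>E\<^sub>\<theta> e\<^sub>n\<close> are parallel, and they have equal norms. Conversely, if \<open>G\<^sub>k\<close> has a pole
  at \<open>\<theta>\<close>, pairing with \<open>w\<close> shows that every \<open>v\<close> vanishes at \<open>k\<close>. Then \<open>v\<close> can be cut off at \<open>G\<^sub>k\<close>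
  (a multiple of \<open>w\<close> on \<open>G\<^sub>k\<close>, zero beyond), which gives an eigenvector that agrees with \<open>v\<close> at
  vertex \<open>1\<close> and vanishes at vertex \<open>n\<close>.
\<close>

section \<open>The spectral theorem for real symmetric matrices\<close>

text \<open>For a complex eigenvector \<open>v\<close> with eigenvalue \<open>z\<close>, the
  Hermitian form \<open>s\<close> equals \<open>z\<close> times the squared norm of
  \<open>v\<close>, and it is its own conjugate because \<open>A\<close> is real and symmetric. So
  \<open>z\<close> is real, and it is already a root of the real characteristic polynomial.\<close>

lemma real_symmetric_has_eigenvalue:
  fixes A :: "real mat"
  assumes A: "A \<in> carrier_mat n n" and sym: "A\<^sup>T = A" and n: "n > 0"
  shows "\<exists>e. eigenvalue A e"
proof -
  let ?B = "map_mat complex_of_real A"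
  have B: "?B \<in> carrier_mat n n" using A by simp
  from char_poly_factorized[OF B] obtain as
    where as: "char_poly ?B = (\<Prod>a\<leftarrow>as. [:- a, 1:])" "length as = n" by auto
  obtain z zs where "as = z # zs" using as(2) n by (cases as) auto
  hence z: "poly (char_poly ?B) z = 0" using as(1) by simp
  then obtain v where v: "eigenvector ?B v z"
    using eigenvalue_root_char_poly[OF B] unfolding eigenvalue_def by blast
  have vc: "v \<in> carrier_vec n" and v0: "v \<noteq> 0\<^sub>v n" and ev: "?B *\<^sub>v v = z \<cdot>\<^sub>v v"
    using v A unfolding eigenvector_def by auto
  have symE: "A $$ (i,j) = A $$ (j,i)" if "i < n" "j < n" for i j
    using that A sym by (metis carrier_matD index_transpose_mat(1))
  have row: "(\<Sum>j<n. of_real (A $$ (i,j)) * v $ j) = z * v $ i" if i: "i < n" for i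
    using arg_cong[OF ev, of "\<lambda>w. w $ i"] i A vc
    by (simp add: scalar_prod_def lessThan_atLeast0)
  define s where "s = (\<Sum>i<n. \<Sum>j<n. cnj (v $ i) * of_real (A $$ (i,j)) * v $ j)"
  define N where "N = (\<Sum>i<n. (cmod (v $ i))\<^sup>2)"
  have "s = (\<Sum>i<n. cnj (v $ i) * (\<Sum>j<n. of_real (A $$ (i,j)) * v $ j))"
    unfolding s_def by (simp add: sum_distrib_left mult.assoc)
  also have "\<dots> = (\<Sum>i<n. z * of_real ((cmod (v $ i))\<^sup>2))"
    by (intro sum.cong refl, subst row)
      (simp_all only: complex_norm_square lessThan_iff mult_ac)
  finally have s: "s = z * of_real N" unfolding N_def by (simp add: sum_distrib_left)
  have "cnj s = (\<Sum>i<n. \<Sum>j<n. v $ i * of_real (A $$ (i,j)) * cnj (v $ j))"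
    unfolding s_def by simp
  also have "\<dots> = (\<Sum>j<n. \<Sum>i<n. v $ i * of_real (A $$ (i,j)) * cnj (v $ j))"
    by (rule sum.swap)
  also have "\<dots> = s" unfolding s_def
    by (intro sum.cong refl) (auto simp: symE mult_ac)
  finally have cs: "cnj s = s" .
  from v0 vc obtain i where i: "i < n" "v $ i \<noteq> 0" by (metis eq_vecI carrier_vecD index_zero_vec)
  have "N > 0" unfolding N_def by (rule sum_pos2[of _ i]) (use i in auto)
  hence "cnj z = z" using cs s by simp
  hence "z = of_real (Re z)" by (metis Reals_cnj_iff of_real_Re)
  hence "poly (map_poly of_real (char_poly A)) (complex_of_real (Re z)) = 0"
    using z of_real_hom.char_poly_hom[OF A] by metis
  hence "poly (char_poly A) (Re z) = 0" by simp
  thus ?thesis using eigenvalue_root_char_poly[OF A] by blast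
qed

lemma sum_kronecker:
  fixes f :: "nat \<Rightarrow> real"
  assumes "i < n"
  shows "(\<Sum>k<n. (if i = k then 1 else 0) * f k) = f i"
    and "(\<Sum>k<n. (if k = i then 1 else 0) * f k) = f i"
proof -
  have "(\<Sum>k<n. (if i = k then 1 else 0) * f k) = (\<Sum>k<n. if i = k then f k else 0)"
    by (intro sum.cong) auto
  thus "(\<Sum>k<n. (if i = k then 1 else 0) * f k) = f i" using assms by simp
  thus "(\<Sum>k<n. (if k = i then 1 else 0) * f k) = f i" by (simp add: eq_commute)
qed

text \<open>The witness is the Householder reflection exchanging \<open>v\<close> and the first unit vector.\<close>
lemma orthogonal_involution_to_unit_vec:
  fixes v :: "real vec"
  assumes v: "v \<in> carrier_vec n" and v1: "v \<bullet> v = 1" and n: "n > 0"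
  shows "\<exists>H \<in> carrier_mat n n. H\<^sup>T = H \<and> H * H = 1\<^sub>m n \<and> H *\<^sub>v unit_vec n 0 = v"
proof (cases "v = unit_vec n 0")
  case True
  thus ?thesis by (intro bexI[of _ "1\<^sub>m n"]) (auto simp: unit_vec_carrier)
next
  case False
  define e :: "nat \<Rightarrow> real" where "e = (\<lambda>i. if i = 0 then 1 else 0)"
  define w where "w i = v $ i - e i" for i
  define s where "s = (\<Sum>i<n. w i * w i)"
  have e0: "(\<Sum>i<n. e i * f i) = f 0" for f :: "nat \<Rightarrow> real"
    unfolding e_def using n by (simp add: if_distrib if_distribR cong: if_cong)
  have e0': "(\<Sum>i<n. f i * e i) = f 0" for f :: "nat \<Rightarrow> real"
    using e0[of f] by (simp add: mult.commute)
  have vv: "(\<Sum>i<n. v $ i * v $ i) = 1" using v1 v by (simp add: scalar_prod_def lessThan_atLeast0)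
  \<comment> \<open>Both vectors have norm one, so \<open>s = 2 - 2 * v $ 0 = - 2 * w 0\<close>.
    This identity is what makes the reflection along \<open>w\<close> send the unit vector to
    \<open>v\<close>.\<close>
  have "s = (\<Sum>i<n. v $ i * v $ i) - 2 * (\<Sum>i<n. v $ i * e i) + (\<Sum>i<n. e i * e i)"
    unfolding s_def w_def by (simp add: algebra_simps sum.distrib sum_subtractf sum_distrib_left)
  hence s: "s = 2 - 2 * v $ 0" using vv e0' e0 by (simp add: e_def)
  have "\<exists>i<n. w i \<noteq> 0"
  proof (rule ccontr)
    assume "\<not> ?thesis"
    hence "v = unit_vec n 0" using v n by (intro eq_vecI) (auto simp: w_def e_def)
    with False show False by simp
  qed
  then obtain i where i: "i < n" "w i \<noteq> 0" by blast
  have s0: "s > 0" unfolding s_def by (rule sum_pos2[of _ i]) (use i in \<open>auto simp: zero_less_mult_iff\<close>)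
  define H where "H = mat n n (\<lambda>(i,j). (if i = j then 1 else 0) - 2 * w i * w j / s)"
  have H: "H \<in> carrier_mat n n" unfolding H_def by simp
  have "(H * H) $$ (i,j) = 1\<^sub>m n $$ (i,j)" if ij: "i < n" "j < n" for i j
  proof -
    let ?d = "\<lambda>i j. if i = j then 1 else (0::real)"
    have "(H * H) $$ (i,j) = (\<Sum>k<n. (?d i k - 2 * w i * w k / s) * (?d k j - 2 * w k * w j / s))"
      using ij by (simp add: H_def scalar_prod_def lessThan_atLeast0)
    also have "\<dots> = (\<Sum>k<n. ?d i k * ?d k j) - (\<Sum>k<n. ?d i k * (2 * w k * w j / s))
        - (\<Sum>k<n. ?d k j * (2 * w i * w k / s)) + (\<Sum>k<n. w k * w k * (4 * w i * w j / (s * s)))"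
      by (simp add: sum.distrib[symmetric] sum_subtractf[symmetric] algebra_simps)
    also have "(\<Sum>k<n. w k * w k * (4 * w i * w j / (s * s))) = s * (4 * w i * w j / (s * s))"
      unfolding sum_distrib_right[symmetric] s_def[symmetric] ..
    also have "(\<Sum>k<n. ?d i k * ?d k j) = ?d i j"
      using ij by (simp only: sum_kronecker)
    also have "(\<Sum>k<n. ?d i k * (2 * w k * w j / s)) = 2 * w i * w j / s"
      using ij by (simp only: sum_kronecker)
    also have "(\<Sum>k<n. ?d k j * (2 * w i * w k / s)) = 2 * w i * w j / s"
      using ij by (simp only: sum_kronecker)
    finally show ?thesis using s0 ij by (simp add: field_simps)
  qed
  hence HH: "H * H = 1\<^sub>m n" using H by (intro eq_matI) auto
  have HT: "H\<^sup>T = H" unfolding H_def by (intro eq_matI) auto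
  have "(H *\<^sub>v unit_vec n 0) $ i = v $ i" if i: "i < n" for i
  proof -
    have "(H *\<^sub>v unit_vec n 0) $ i = H $$ (i,0)"
      using i H n by simp
    also have "\<dots> = e i - 2 * w i * w 0 / s" unfolding H_def e_def using i n by simp
    also have "2 * w i * w 0 = - s * w i" using s unfolding w_def e_def by simp
    also have "- s * w i / s = - w i" using s0 by simp
    finally show ?thesis unfolding w_def by simp
  qed
  hence "H *\<^sub>v unit_vec n 0 = v" using v H by (intro eq_vecI) auto
  with HH HT H show ?thesis by blast
qed

lemma mult_mat_regroup5:
  assumes "U \<in> carrier_mat n n" "V \<in> carrier_mat n n" "W \<in> carrier_mat n n"
    "X \<in> carrier_mat n n" "Y \<in> carrier_mat n n"
  shows "U * V * W * (X * Y) = U * (V * W * X) * Y"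
  using assms by (simp add: assoc_mult_mat[of _ n n _ n _ n] mult_carrier_mat[of _ n n _ n])

text \<open>Deflation: conjugating with a reflection that takes the first unit vector to a unit
  eigenvector splits off a 1 by 1 block, and the remaining symmetric block is smaller by
  one.\<close>

lemma real_symmetric_diagonalization:
  fixes A :: "real mat"
  assumes "A \<in> carrier_mat n n" and "A\<^sup>T = A"
  shows "\<exists>P b. P \<in> carrier_mat n n \<and> P\<^sup>T * P = 1\<^sub>m n \<and> A = P * mat_diag n b * P\<^sup>T"
  using assms
proof (induction n arbitrary: A)
  case 0
  thus ?case by (intro exI[of _ "0\<^sub>m 0 0"] exI[of _ "\<lambda>_. 0"]) auto
next
  case (Suc n)
  note A = Suc.prems(1) and sym = Suc.prems(2)
  obtain e v where "eigenvector A v e"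
    using real_symmetric_has_eigenvalue[OF A sym] unfolding eigenvalue_def by auto
  hence v: "v \<in> carrier_vec (Suc n)" "v \<noteq> 0\<^sub>v (Suc n)" "A *\<^sub>v v = e \<cdot>\<^sub>v v"
    using A unfolding eigenvector_def by auto
  define c where "c = (\<Sum>i<Suc n. v $ i * v $ i)"
  have vv: "v \<bullet> v = c" using v(1) unfolding c_def scalar_prod_def by (simp add: lessThan_atLeast0)
  obtain i where i: "i < Suc n" "v $ i \<noteq> 0"
    using v(1,2) by (metis eq_vecI carrier_vecD index_zero_vec)
  have c0: "c > 0" unfolding c_def
    by (rule sum_pos2[of _ i]) (use i in \<open>auto simp: zero_less_mult_iff\<close>)
  define u where "u = (1 / sqrt c) \<cdot>\<^sub>v v"
  have u: "u \<in> carrier_vec (Suc n)" using v(1) unfolding u_def by simp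
  have uu: "u \<bullet> u = 1" unfolding u_def using v(1) c0 vv by (simp add: field_simps)
  have Au: "A *\<^sub>v u = e \<cdot>\<^sub>v u" unfolding u_def using v A
    by (simp add: mult_mat_vec smult_smult_assoc mult.commute)
  obtain H where H: "H \<in> carrier_mat (Suc n) (Suc n)" "H\<^sup>T = H" "H * H = 1\<^sub>m (Suc n)"
    and Hu: "H *\<^sub>v unit_vec (Suc n) 0 = u"
    using orthogonal_involution_to_unit_vec[OF u uu] by auto
  \<comment> \<open>The first unit vector is an eigenvector of \<open>A'\<close>, so the first
    column vanishes below the diagonal; by symmetry so does the rest of the first row.\<close>
  define A' where "A' = H * A * H"
  have A': "A' \<in> carrier_mat (Suc n) (Suc n)" unfolding A'_def using H A by simp
  have A'T: "A'\<^sup>T = A'" unfolding A'_def using H A sym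
    by (simp add: transpose_mult[of _ "Suc n" "Suc n" _ "Suc n"] assoc_mult_mat[of _ "Suc n" "Suc n" _ "Suc n" _ "Suc n"])
  have Hu': "H *\<^sub>v u = unit_vec (Suc n) 0"
    using H Hu by (metis assoc_mult_mat_vec one_mult_mat_vec unit_vec_carrier)
  have "A' *\<^sub>v unit_vec (Suc n) 0 = e \<cdot>\<^sub>v unit_vec (Suc n) 0"
    unfolding A'_def using H(1) A u Hu Au Hu'
    by (simp add: assoc_mult_mat_vec[of _ "Suc n" "Suc n" _ "Suc n"] mult_mat_vec)
  hence Ae: "(A' *\<^sub>v unit_vec (Suc n) 0) $ i = (e \<cdot>\<^sub>v unit_vec (Suc n) 0) $ i" for i by simp
  have col0: "A' $$ (i,0) = (if i = 0 then e else 0)" if "i < Suc n" for i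
    using that A' Ae[of i] by (auto split: if_splits)
  have row0: "A' $$ (0,i) = (if i = 0 then e else 0)" if "i < Suc n" for i
    using col0[OF that] that A' A'T by (metis carrier_matD index_transpose_mat(1) zero_less_Suc)
  \<comment> \<open>\<open>F X c\<close> is the block diagonal matrix with corner \<open>c\<close>.
    It respects products and transposes, so a factorization of size \<open>n\<close> lifts to size
    \<open>Suc n\<close>.\<close>
  define F :: "real mat \<Rightarrow> real \<Rightarrow> real mat"
    where "F X c = four_block_mat (mat 1 1 (\<lambda>_. c)) (0\<^sub>m 1 n) (0\<^sub>m n 1) X" for X c
  have F[simp]: "F X c \<in> carrier_mat (Suc n) (Suc n)" if "X \<in> carrier_mat n n" for X c
    using that unfolding F_def by (metis four_block_carrier_mat mat_carrier plus_1_eq_Suc)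
  have FF: "F X c * F Y d = F (X * Y) (c * d)"
    if "X \<in> carrier_mat n n" "Y \<in> carrier_mat n n" for X Y c d
  proof -
    have m: "mat (Suc 0) (Suc 0) (\<lambda>_. c) * mat (Suc 0) (Suc 0) (\<lambda>_. d) + 0\<^sub>m (Suc 0) (Suc 0)
        = mat (Suc 0) (Suc 0) (\<lambda>_. c * d)"
      by (intro eq_matI) (auto simp: scalar_prod_def)
    show ?thesis unfolding F_def
      by (subst mult_four_block_mat[of _ 1 1 _ n _ n _ _ 1 _ n]) (use that in \<open>auto simp: m\<close>)
  qed
  have FT: "(F X c)\<^sup>T = F (X\<^sup>T) c" if "X \<in> carrier_mat n n" for X c
    unfolding F_def by (subst transpose_four_block_mat[of _ 1 1 _ n _ n]) (use that in \<open>auto intro: eq_matI\<close>)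
  define A3 where "A3 = mat n n (\<lambda>(i,j). A' $$ (Suc i, Suc j))"
  have A3: "A3 \<in> carrier_mat n n" unfolding A3_def by simp
  have "A' $$ (i,j) = A' $$ (j,i)" if "i < Suc n" "j < Suc n" for i j
    using that A' A'T by (metis carrier_matD index_transpose_mat(1))
  hence A3T: "A3\<^sup>T = A3" unfolding A3_def by (intro eq_matI) auto
  have A'F: "A' = F A3 e" unfolding F_def
    by (rule eq_matI) (use A' A3 col0 row0 in \<open>auto simp: A3_def\<close>)
  obtain Q b where Q: "Q \<in> carrier_mat n n" "Q\<^sup>T * Q = 1\<^sub>m n" "A3 = Q * mat_diag n b * Q\<^sup>T"
    using Suc.IH[OF A3 A3T] by auto
  define P where "P = H * F Q 1"
  have P: "P \<in> carrier_mat (Suc n) (Suc n)" unfolding P_def using H Q by simp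
  have PT: "P\<^sup>T = F (Q\<^sup>T) 1 * H" unfolding P_def using H Q FT
    by (simp add: transpose_mult[of _ "Suc n" "Suc n" _ "Suc n"])
  have F1: "F (1\<^sub>m n) 1 = 1\<^sub>m (Suc n)"
    unfolding F_def by (rule eq_matI) auto
  have FD: "mat_diag (Suc n) (case_nat e b) = F (mat_diag n b) e"
    unfolding F_def mat_diag_def by (rule eq_matI) (auto split: nat.splits)
  note assoc = assoc_mult_mat[of _ "Suc n" "Suc n" _ "Suc n" _ "Suc n"]
  have QT: "Q\<^sup>T \<in> carrier_mat n n" using Q by simp
  have "P\<^sup>T * P = F (Q\<^sup>T) 1 * ((H * H) * F Q 1)"
    unfolding PT unfolding P_def using H(1) Q QT by (simp add: assoc)
  also have "\<dots> = F (Q\<^sup>T) 1 * F Q 1" using H(3) Q by (simp add: left_mult_one_mat[OF F])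
  also have "\<dots> = 1\<^sub>m (Suc n)" using FF Q QT F1 by simp
  finally have 1: "P\<^sup>T * P = 1\<^sub>m (Suc n)" .
  have "P * mat_diag (Suc n) (case_nat e b) * P\<^sup>T
      = H * (F Q 1 * F (mat_diag n b) e * F (Q\<^sup>T) 1) * H"
    unfolding PT FD unfolding P_def by (rule mult_mat_regroup5[of _ "Suc n"]) (use H(1) Q QT in auto)
  also have "F Q 1 * F (mat_diag n b) e * F (Q\<^sup>T) 1 = A'"
    using Q QT FF A'F by simp
  also have "H * A' * H = (H * H) * A * (H * H)"
    unfolding A'_def using H(1) A by (simp add: assoc)
  also have "\<dots> = A" using H(3) A by simp
  finally show ?case using P 1 by metis
qed

section \<open>Characteristic polynomials in an orthonormal eigenbasis\<close>

text \<open>The spectral theorem in coordinates: column \<open>k\<close> of \<open>P\<close> is a unit eigenvector for \<open>b k\<close>.\<close>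
definition eigen_coords :: "nat \<Rightarrow> real mat \<Rightarrow> (nat \<Rightarrow> nat \<Rightarrow> real) \<Rightarrow> (nat \<Rightarrow> real) \<Rightarrow> bool" where
  "eigen_coords n A P b \<longleftrightarrow>
    (\<forall>i<n. \<forall>j<n. A $$ (i,j) = (\<Sum>k<n. b k * P i k * P j k)) \<and>
    (\<forall>i<n. \<forall>j<n. (\<Sum>k<n. P i k * P j k) = (if i = j then 1 else 0)) \<and>
    (\<forall>k<n. \<forall>l<n. (\<Sum>i<n. P i k * P i l) = (if k = l then 1 else 0)) \<and>
    char_poly A = (\<Prod>k<n. [:- b k, 1:]) \<and>
    (\<forall>i<n. char_poly (mat_delete A i i) =
      (\<Sum>k<n. Polynomial.smult (P i k * P i k) (\<Prod>l\<in>{..<n} - {k}. [:- b l, 1:])))"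

lemma cofactor_char_poly_matrix:
  fixes A :: "real mat"
  assumes A: "A \<in> carrier_mat n n" and i: "i < n"
  shows "Determinant.adj_mat (char_poly_matrix A) $$ (i,i) = char_poly (mat_delete A i i)"
proof -
  have "mat_delete (char_poly_matrix A) i i = char_poly_matrix (mat_delete A i i)"
    using A i by (intro eq_matI) (auto simp: mat_delete_def char_poly_matrix_def)
  thus ?thesis using A i
    by (simp add: Determinant.adj_mat_def cofactor_def char_poly_def char_poly_matrix_def)
qed

lemma sum_const_poly: "(\<Sum>k<n. [:f k:]) = [:\<Sum>k<n. f k:]" for f :: "nat \<Rightarrow> real" and n :: nat
  by (induction n) auto

text \<open>The vertex-deleted polynomials are the diagonal entries of the adjugate of
  \<open>xI - A\<close>, so it suffices to compute that adjugate from the spectral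
  decomposition.\<close>

lemma eigen_coords_exist:
  fixes A :: "real mat"
  assumes A: "A \<in> carrier_mat n n" and sym: "A\<^sup>T = A"
  shows "\<exists>P b. eigen_coords n A P b"
proof -
  obtain Q b where Q: "Q \<in> carrier_mat n n" "Q\<^sup>T * Q = 1\<^sub>m n" "A = Q * mat_diag n b * Q\<^sup>T"
    using real_symmetric_diagonalization[OF A sym] by auto
  have Q2: "Q * Q\<^sup>T = 1\<^sub>m n" using mat_mult_left_right_inverse[of "Q\<^sup>T" n Q] Q by simp
  define P where "P i k = Q $$ (i,k)" for i k
  have o1: "(\<Sum>i<n. P i k * P i l) = (if k = l then 1 else 0)" if "k < n" "l < n" for k l
    using arg_cong[OF Q(2), of "\<lambda>M. M $$ (k,l)"] that Q(1)
    by (simp add: scalar_prod_def P_def lessThan_atLeast0)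
  have o2: "(\<Sum>k<n. P i k * P j k) = (if i = j then 1 else 0)" if "i < n" "j < n" for i j
    using arg_cong[OF Q2, of "\<lambda>M. M $$ (i,j)"] that Q(1)
    by (simp add: scalar_prod_def P_def lessThan_atLeast0)
  have Aij: "A $$ (i,j) = (\<Sum>k<n. b k * P i k * P j k)" if "i < n" "j < n" for i j
    unfolding Q(3) mat_diag_mult_right[OF Q(1)] using that Q(1)
    by (simp add: scalar_prod_def P_def lessThan_atLeast0 mult_ac)
  have "similar_mat_wit A (mat_diag n b) Q (Q\<^sup>T)"
    using Q Q2 A by (intro similar_mat_witI[of _ _ n]) auto
  hence "char_poly A = char_poly (mat_diag n b)"
    by (intro char_poly_similar) (auto simp: similar_mat_def)
  also have "\<dots> = (\<Prod>a\<leftarrow>diag_mat (mat_diag n b). [:- a, 1:])"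
    by (rule char_poly_upper_triangular[of _ n]) (auto simp: mat_diag_def)
  also have "\<dots> = (\<Prod>k<n. [:- b k, 1:])"
  proof -
    have "diag_mat (mat_diag n b) = map b [0..<n]"
      by (auto simp: diag_mat_def mat_diag_def)
    thus ?thesis by (simp add: o_def prod.distinct_set_conv_list[symmetric] lessThan_atLeast0)
  qed
  finally have cp: "char_poly A = (\<Prod>k<n. [:- b k, 1:])" .
  define \<phi> where "\<phi> = char_poly A"
  define M where "M = char_poly_matrix A"
  define R where "R k = (\<Prod>l\<in>{..<n} - {k}. [:- b l, 1:])" for k
  \<comment> \<open>The expected adjugate: \<open>\<phi>\<close> times the resolvent, where
    \<open>R k\<close> is \<open>\<phi> / (x - b k)\<close> written without division.\<close>
  define N where "N = mat n n (\<lambda>(i,j). \<Sum>k<n. Polynomial.smult (P i k * P j k) (R k))"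
  have M: "M \<in> carrier_mat n n" unfolding M_def using A by simp
  have N: "N \<in> carrier_mat n n" unfolding N_def by simp
  have Mij: "M $$ (i,j) = (\<Sum>k<n. Polynomial.smult (P i k * P j k) [:- b k, 1:])" if "i < n" "j < n" for i j
  proof -
    have "(\<Sum>k<n. Polynomial.smult (P i k * P j k) [:- b k, 1:])
        = (\<Sum>k<n. [:- (b k * P i k * P j k):]) + (\<Sum>k<n. Polynomial.smult (P i k * P j k) [:0,1:])"
      by (simp add: sum.distrib[symmetric] mult_ac)
    also have "(\<Sum>k<n. [:- (b k * P i k * P j k):]) = [:- (A $$ (i,j)):]"
      by (simp only: Aij[OF that] sum_const_poly sum_negf)
    also have "(\<Sum>k<n. Polynomial.smult (P i k * P j k) [:0,1:]) = Polynomial.smult (if i = j then 1 else 0) [:0,1:]"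
      by (simp only: o2[OF that, symmetric] smult_sum)
    finally show ?thesis using that A unfolding M_def char_poly_matrix_def by simp
  qed
  have "(M * N) $$ (i,j) = (\<phi> \<cdot>\<^sub>m 1\<^sub>m n) $$ (i,j)" if ij: "i < n" "j < n" for i j
  proof -
    have R: "[:- b k, 1:] * R k = \<phi>" if "k < n" for k
      unfolding \<phi>_def cp R_def using that by (subst prod.remove[of _ k]) auto
    have "(M * N) $$ (i,j) = (\<Sum>t<n. (\<Sum>k<n. Polynomial.smult (P i k * P t k) [:- b k, 1:]) * (\<Sum>l<n. Polynomial.smult (P t l * P j l) (R l)))"
      using ij M N Mij by (simp add: scalar_prod_def N_def lessThan_atLeast0)
    \<comment> \<open>The factors are grouped so that the sum over \<open>t\<close>, once moved
      inside, is the inner product of columns \<open>k\<close> and \<open>l\<close>; only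
      \<open>k = l\<close> survives.\<close>
    also have "\<dots> = (\<Sum>t<n. \<Sum>k<n. \<Sum>l<n. Polynomial.smult (P t k * P t l) (Polynomial.smult (P i k * P j l) ([:- b k, 1:] * R l)))"
      by (simp only: sum_product mult_smult_left mult_smult_right smult_smult, simp only: mult_ac)
    also have "\<dots> = (\<Sum>k<n. \<Sum>t<n. \<Sum>l<n. Polynomial.smult (P t k * P t l) (Polynomial.smult (P i k * P j l) ([:- b k, 1:] * R l)))"
      by (rule sum.swap)
    also have "\<dots> = (\<Sum>k<n. \<Sum>l<n. \<Sum>t<n. Polynomial.smult (P t k * P t l) (Polynomial.smult (P i k * P j l) ([:- b k, 1:] * R l)))"
      by (intro sum.cong refl sum.swap)
    also have "\<dots> = (\<Sum>k<n. \<Sum>l<n. Polynomial.smult (if k = l then 1 else 0) (Polynomial.smult (P i k * P j l) ([:- b k, 1:] * R l)))"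
      by (intro sum.cong refl) (simp only: smult_sum[symmetric] o1 lessThan_iff)
    also have "\<dots> = (\<Sum>k<n. \<Sum>l<n. if k = l then Polynomial.smult (P i k * P j l) ([:- b k, 1:] * R l) else 0)"
      by (intro sum.cong refl) (simp only: smult_1_left smult_0_left split: if_splits, simp)
    also have "\<dots> = (\<Sum>k<n. Polynomial.smult (P i k * P j k) \<phi>)"
      by (intro sum.cong refl) (simp add: R del: mult_pCons_left)
    also have "\<dots> = Polynomial.smult (if i = j then 1 else 0) \<phi>"
      by (simp only: smult_sum[symmetric] o2[OF ij])
    finally show ?thesis using ij by simp
  qed
  hence MN: "M * N = \<phi> \<cdot>\<^sub>m 1\<^sub>m n" using M N by (intro eq_matI) auto
  \<comment> \<open>\<open>N\<close> is a right inverse of \<open>M\<close> up to the factor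
    \<open>\<phi>\<close>, and the adjugate is a left one. Evaluating \<open>?J * M * N\<close> in
    both ways and cancelling \<open>\<phi>\<close> identifies their entries.\<close>
  let ?J = "Determinant.adj_mat M"
  have J: "?J \<in> carrier_mat n n" "?J * M = \<phi> \<cdot>\<^sub>m 1\<^sub>m n"
    using Determinant.adj_mat[OF M] unfolding \<phi>_def char_poly_def M_def by auto
  have "\<phi> \<cdot>\<^sub>m N = (?J * M) * N" unfolding J(2) using N by (simp add: mult_smult_assoc_mat[of _ n n _ n])
  also have "\<dots> = ?J * (M * N)" using J(1) M N by (rule assoc_mult_mat)
  also have "\<dots> = \<phi> \<cdot>\<^sub>m ?J" unfolding MN using J by (simp add: mult_smult_distrib[of _ n n _ n])
  finally have eq: "\<phi> \<cdot>\<^sub>m N = \<phi> \<cdot>\<^sub>m ?J" .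
  have \<phi>0: "\<phi> \<noteq> 0" unfolding \<phi>_def cp by simp
  have "char_poly (mat_delete A i i) = (\<Sum>k<n. Polynomial.smult (P i k * P i k) (R k))" if i: "i < n" for i
  proof -
    have "\<phi> * N $$ (i,i) = \<phi> * ?J $$ (i,i)"
      using arg_cong[OF eq, of "\<lambda>M. M $$ (i,i)"] i N J by simp
    hence "?J $$ (i,i) = N $$ (i,i)" using \<phi>0 by simp
    thus ?thesis using cofactor_char_poly_matrix[OF A i] i unfolding M_def N_def by simp
  qed
  hence "eigen_coords n A P b" unfolding eigen_coords_def R_def using o1 o2 Aij cp by blast
  thus ?thesis by blast
qed

section \<open>Equations and poles in eigenbasis coordinates\<close>

context
  fixes n :: nat and A :: "real mat" and P :: "nat \<Rightarrow> nat \<Rightarrow> real" and b :: "nat \<Rightarrow> real"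
  assumes A: "A \<in> carrier_mat n n" and ec: "eigen_coords n A P b"
begin

lemma entry_coords: "i < n \<Longrightarrow> j < n \<Longrightarrow> A $$ (i,j) = (\<Sum>k<n. b k * P i k * P j k)"
  and rows_orthonormal: "i < n \<Longrightarrow> j < n \<Longrightarrow> (\<Sum>k<n. P i k * P j k) = (if i = j then 1 else 0)"
  and cols_orthonormal: "k < n \<Longrightarrow> l < n \<Longrightarrow> (\<Sum>i<n. P i k * P i l) = (if k = l then 1 else 0)"
  and char_poly_coords: "char_poly A = (\<Prod>k<n. [:- b k, 1:])"
  and char_poly_delete_coords: "i < n \<Longrightarrow> char_poly (mat_delete A i i) =
      (\<Sum>k<n. Polynomial.smult (P i k * P i k) (\<Prod>l\<in>{..<n} - {k}. [:- b l, 1:]))"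
  using ec unfolding eigen_coords_def by blast+

text \<open>The columns of \<open>P\<close> are orthonormal eigenvectors, so \<open>A\<close> just
  scales their coefficients. This turns \<open>(A - \<theta>) v = e_i\<close> into one scalar
  equation for each \<open>k\<close>.\<close>

lemma mult_coords:
  assumes t: "t < n"
  shows "(\<Sum>j<n. A $$ (t,j) * (\<Sum>k<n. c k * P j k)) = (\<Sum>k<n. b k * c k * P t k)"
proof -
  have "(\<Sum>j<n. A $$ (t,j) * (\<Sum>k<n. c k * P j k))
      = (\<Sum>j<n. \<Sum>l<n. \<Sum>k<n. P j l * P j k * (b l * P t l * c k))"
    using t by (intro sum.cong refl) (simp only: entry_coords sum_product lessThan_iff, simp only: mult_ac)
  also have "\<dots> = (\<Sum>l<n. \<Sum>j<n. \<Sum>k<n. P j l * P j k * (b l * P t l * c k))"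
    by (rule sum.swap)
  also have "\<dots> = (\<Sum>l<n. \<Sum>k<n. \<Sum>j<n. P j l * P j k * (b l * P t l * c k))"
    by (intro sum.cong refl sum.swap)
  also have "\<dots> = (\<Sum>l<n. \<Sum>k<n. (if l = k then 1 else 0) * (b l * P t l * c k))"
    by (intro sum.cong refl) (simp only: sum_distrib_right[symmetric] cols_orthonormal lessThan_iff)
  also have "\<dots> = (\<Sum>l<n. b l * P t l * c l)"
    by (intro sum.cong refl) (simp only: sum_kronecker lessThan_iff)
  finally show ?thesis by (simp add: mult_ac)
qed

lemma coords_expand:
  assumes i: "i < n"
  shows "(\<Sum>k<n. P i k * (\<Sum>j<n. P j k * v j)) = v i"
proof -
  have "(\<Sum>k<n. P i k * (\<Sum>j<n. P j k * v j)) = (\<Sum>k<n. \<Sum>j<n. P i k * P j k * v j)"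
    by (simp add: sum_distrib_left mult_ac)
  also have "\<dots> = (\<Sum>j<n. \<Sum>k<n. P i k * P j k * v j)" by (rule sum.swap)
  also have "\<dots> = (\<Sum>j<n. (if i = j then 1 else 0) * v j)"
    using i by (intro sum.cong refl) (simp only: sum_distrib_right[symmetric] rows_orthonormal lessThan_iff)
  finally show ?thesis using i by (simp only: sum_kronecker)
qed

lemma coords_mult:
  assumes k: "k < n"
  shows "(\<Sum>t<n. P t k * (\<Sum>j<n. A $$ (t,j) * v j)) = b k * (\<Sum>j<n. P j k * v j)"
proof -
  have "(\<Sum>t<n. P t k * (\<Sum>j<n. A $$ (t,j) * v j)) = (\<Sum>t<n. \<Sum>j<n. A $$ (t,j) * P t k * v j)"
    by (simp add: sum_distrib_left mult_ac)
  also have "\<dots> = (\<Sum>j<n. \<Sum>t<n. A $$ (t,j) * P t k * v j)" by (rule sum.swap)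
  also have "\<dots> = (\<Sum>j<n. (\<Sum>t<n. A $$ (j,t) * P t k) * v j)"
    unfolding sum_distrib_right[symmetric]
    by (intro sum.cong refl arg_cong2[of _ _ _ _ times])
      (simp_all only: entry_coords lessThan_iff mult_ac)
  \<comment> \<open>Column \<open>k\<close> is written as a combination of all columns with
    Kronecker coefficients, which is the form that \<open>mult_coords\<close> expects.\<close>
  also have "\<dots> = (\<Sum>j<n. (\<Sum>t<n. A $$ (j,t) * (\<Sum>l<n. (if k = l then 1 else 0) * P t l)) * v j)"
    using k by (simp only: sum_kronecker)
  also have "\<dots> = (\<Sum>j<n. (\<Sum>l<n. b l * (if k = l then 1 else 0) * P j l) * v j)"
    by (intro sum.cong refl) (simp only: mult_coords lessThan_iff)
  also have "\<dots> = (\<Sum>j<n. (\<Sum>l<n. (if k = l then 1 else 0) * (b l * P j l)) * v j)"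
    by (simp only: mult_ac)
  also have "\<dots> = (\<Sum>j<n. b k * P j k * v j)"
    using k by (simp only: sum_kronecker)
  finally show ?thesis by (simp add: sum_distrib_left mult_ac)
qed

text \<open>The factor \<open>x - \<theta>\<close> on the left avoids the exponent \<open>card K - 1\<close>, which truncates if \<open>\<theta>\<close> is no eigenvalue.\<close>
lemma char_poly_split:
  fixes \<theta> :: real
  defines "K \<equiv> {k. k < n \<and> b k = \<theta>}" and "L \<equiv> {k. k < n \<and> b k \<noteq> \<theta>}"
  defines "\<psi> \<equiv> (\<Prod>k\<in>L. [:- b k, 1:])"
  shows "char_poly A = [:- \<theta>, 1:] ^ card K * \<psi>"
    and "poly \<psi> \<theta> \<noteq> 0"
    and "i < n \<Longrightarrow> \<exists>g. [:- \<theta>, 1:] * char_poly (mat_delete A i i) =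
        [:- \<theta>, 1:] ^ card K * (Polynomial.smult (\<Sum>k\<in>K. P i k * P i k) \<psi> + [:- \<theta>, 1:] * g) \<and>
        poly g \<theta> = poly \<psi> \<theta> * (\<Sum>k\<in>L. P i k * P i k / (\<theta> - b k))"
proof -
  let ?q = "\<lambda>k. [:- b k, 1:]" and ?X = "[:- \<theta>, 1:]"
  have fin: "finite K" "finite L" and dis: "K \<inter> L = {}" and un: "{..<n} = K \<union> L"
    unfolding K_def L_def by auto
  have XK: "(\<Prod>k\<in>K. ?q k) = ?X ^ card K" unfolding K_def by simp
  show cp: "char_poly A = ?X ^ card K * \<psi>"
    unfolding char_poly_coords un \<psi>_def using fin dis XK by (simp add: prod.union_disjoint)
  show \<psi>0: "poly \<psi> \<theta> \<noteq> 0" unfolding \<psi>_def poly_prod using fin by (auto simp: L_def)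
  assume i: "i < n"
  \<comment> \<open>For \<open>k \<in> L\<close>, \<open>h k\<close> is
    \<open>\<psi> / (x - b k)\<close>, so \<open>g\<close> collects the contributions of the
    eigenvalues other than \<open>\<theta>\<close>, freed of the common power of
    \<open>x - \<theta>\<close>.\<close>
  define h where "h k = (\<Prod>l\<in>L - {k}. ?q l)" for k
  define g where "g = (\<Sum>k\<in>L. Polynomial.smult (P i k * P i k) (h k))"
  have inK: "?X * (\<Prod>l\<in>{..<n} - {k}. ?q l) = ?X ^ card K * \<psi>" if "k \<in> K" for k
  proof -
    have "(\<Prod>k<n. ?q k) = ?q k * (\<Prod>l\<in>{..<n} - {k}. ?q l)"
      by (rule prod.remove) (use that in \<open>auto simp: K_def\<close>)
    thus ?thesis using that cp char_poly_coords by (simp add: K_def)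
  qed
  have inL: "(\<Prod>l\<in>{..<n} - {k}. ?q l) = ?X ^ card K * h k" if k: "k \<in> L" for k
  proof -
    have U: "{..<n} - {k} = K \<union> (L - {k})" using k dis un by auto
    have "(\<Prod>l\<in>{..<n} - {k}. ?q l) = (\<Prod>l\<in>K. ?q l) * h k"
      unfolding U h_def by (rule prod.union_disjoint) (use fin dis in auto)
    thus ?thesis unfolding XK .
  qed
  have "?X * char_poly (mat_delete A i i)
     = (\<Sum>k<n. Polynomial.smult (P i k * P i k) (?X * (\<Prod>l\<in>{..<n} - {k}. ?q l)))"
    unfolding char_poly_delete_coords[OF i] sum_distrib_left by (simp only: mult_smult_right)
  also have "\<dots> = (\<Sum>k\<in>K. Polynomial.smult (P i k * P i k) (?X * (\<Prod>l\<in>{..<n} - {k}. ?q l)))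
      + (\<Sum>k\<in>L. Polynomial.smult (P i k * P i k) (?X * (\<Prod>l\<in>{..<n} - {k}. ?q l)))"
    by (subst (1) un) (use fin dis in \<open>simp only: sum.union_disjoint\<close>)
  also have "(\<Sum>k\<in>K. Polynomial.smult (P i k * P i k) (?X * (\<Prod>l\<in>{..<n} - {k}. ?q l)))
      = (\<Sum>k\<in>K. Polynomial.smult (P i k * P i k) (?X ^ card K * \<psi>))"
    by (intro sum.cong refl) (simp only: inK)
  also have "(\<Sum>k\<in>L. Polynomial.smult (P i k * P i k) (?X * (\<Prod>l\<in>{..<n} - {k}. ?q l)))
      = (\<Sum>k\<in>L. Polynomial.smult (P i k * P i k) (?X * (?X ^ card K * h k)))"
    by (intro sum.cong refl) (simp only: inL)
  also have "\<dots> = ?X ^ card K * (?X * g)"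
    unfolding g_def sum_distrib_left by (simp only: mult_smult_right mult_ac)
  also have "(\<Sum>k\<in>K. Polynomial.smult (P i k * P i k) (?X ^ card K * \<psi>))
      = ?X ^ card K * Polynomial.smult (\<Sum>k\<in>K. P i k * P i k) \<psi>"
    by (simp only: smult_sum mult_smult_right sum_distrib_left)
  finally have 1: "?X * char_poly (mat_delete A i i)
      = ?X ^ card K * (Polynomial.smult (\<Sum>k\<in>K. P i k * P i k) \<psi> + ?X * g)"
    by (simp only: distrib_left)
  have "poly (h k) \<theta> = poly \<psi> \<theta> / (\<theta> - b k)" if k: "k \<in> L" for k
  proof -
    have "\<psi> = ?q k * h k" unfolding \<psi>_def h_def using fin(2) k by (rule prod.remove)
    moreover have "\<theta> \<noteq> b k" using k by (auto simp: L_def)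
    ultimately show ?thesis by (simp add: left_diff_distrib[symmetric])
  qed
  hence 2: "poly g \<theta> = poly \<psi> \<theta> * (\<Sum>k\<in>L. P i k * P i k / (\<theta> - b k))"
    unfolding g_def poly_sum sum_distrib_left by (intro sum.cong refl) simp
  from 1 2 show "\<exists>g. ?X * char_poly (mat_delete A i i) =
        ?X ^ card K * (Polynomial.smult (\<Sum>k\<in>K. P i k * P i k) \<psi> + ?X * g) \<and>
        poly g \<theta> = poly \<psi> \<theta> * (\<Sum>k\<in>L. P i k * P i k / (\<theta> - b k))" by blast
qed

text \<open>Once the power of \<open>x - \<theta>\<close> is cancelled, evaluation at
  \<open>\<theta>\<close> removes \<open>g\<close> and leaves the sum of squares times
  \<open>poly \<psi> \<theta>\<close>, which is non-zero. The two sums are the squared norms of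
  \<open>E_\<theta> e_i\<close> and \<open>E_\<theta> e_j\<close>.\<close>

lemma sum_squares_coords_eq:
  assumes ij: "i < n" "j < n" and eq: "char_poly (mat_delete A i i) = char_poly (mat_delete A j j)"
  shows "(\<Sum>k | k < n \<and> b k = \<theta>. P i k * P i k) = (\<Sum>k | k < n \<and> b k = \<theta>. P j k * P j k)"
    (is "?C i = ?C j")
proof -
  define \<psi> where "\<psi> = (\<Prod>k | k < n \<and> b k \<noteq> \<theta>. [:- b k, 1:])"
  define X where "X = [:- \<theta>, 1:]"
  have X: "X \<noteq> 0" "poly X \<theta> = 0" unfolding X_def by auto
  let ?K = "{k. k < n \<and> b k = \<theta>}"
  obtain g where g: "X * char_poly (mat_delete A i i) =
      X ^ card ?K * (Polynomial.smult (?C i) \<psi> + X * g)"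
    using char_poly_split(3)[OF ij(1), of \<theta>] unfolding \<psi>_def X_def by blast
  obtain h where h: "X * char_poly (mat_delete A j j) =
      X ^ card ?K * (Polynomial.smult (?C j) \<psi> + X * h)"
    using char_poly_split(3)[OF ij(2), of \<theta>] unfolding \<psi>_def X_def by blast
  have "X ^ card ?K \<noteq> 0" using X by simp
  moreover have "X ^ card ?K * (Polynomial.smult (?C i) \<psi> + X * g)
      = X ^ card ?K * (Polynomial.smult (?C j) \<psi> + X * h)"
    unfolding g[symmetric] h[symmetric] eq ..
  ultimately have "Polynomial.smult (?C i) \<psi> + X * g = Polynomial.smult (?C j) \<psi> + X * h"
    using mult_left_cancel by blast
  hence "poly (Polynomial.smult (?C i) \<psi> + X * g) \<theta> = poly (Polynomial.smult (?C j) \<psi> + X * h) \<theta>"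
    by simp
  thus ?thesis using char_poly_split(2)[of \<theta>] unfolding \<psi>_def[symmetric] by (simp add: X)
qed

text \<open>Near \<open>\<theta>\<close>, the reciprocal of \<open>\<alpha>_i\<close> is
  \<open>C / (x - \<theta>)\<close> plus a function that is regular at \<open>\<theta>\<close> with
  value \<open>S\<close> there. A pole of \<open>\<alpha>_i\<close> is a zero of this reciprocal, so
  both \<open>C\<close> and \<open>S\<close> must vanish; \<open>C\<close> is a sum of
  squares.\<close>

lemma alpha_pole_coords:
  assumes i: "i < n"
  shows "alpha_pole A i \<theta> \<longleftrightarrow> (\<forall>k<n. b k = \<theta> \<longrightarrow> P i k = 0) \<and>
    (\<Sum>k | k < n \<and> b k \<noteq> \<theta>. P i k * P i k / (\<theta> - b k)) = 0"
proof -
  define \<psi> where "\<psi> = (\<Prod>k | k < n \<and> b k \<noteq> \<theta>. [:- b k, 1:])"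
  define C where "C = (\<Sum>k | k < n \<and> b k = \<theta>. P i k * P i k)"
  define S where "S = (\<Sum>k | k < n \<and> b k \<noteq> \<theta>. P i k * P i k / (\<theta> - b k))"
  define m where "m = card {k. k < n \<and> b k = \<theta>}"
  define \<phi> where "\<phi> = char_poly (mat_delete A i i)"
  define X where "X = [:- \<theta>, 1:]"
  have X: "X \<noteq> 0" "poly X \<theta> = 0" "order \<theta> X = 1" "order \<theta> (X ^ r) = r" for r
    using order_power_n_n[of \<theta> 1] order_power_n_n[of \<theta> r] unfolding X_def by auto
  obtain g where g: "X * \<phi> = X ^ m * (Polynomial.smult C \<psi> + X * g)" "poly g \<theta> = poly \<psi> \<theta> * S"
    using char_poly_split(3)[OF i, of \<theta>] unfolding \<psi>_def \<phi>_def C_def S_def m_def X_def by blast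
  define q where "q = Polynomial.smult C \<psi> + X * g"
  have \<psi>0: "poly \<psi> \<theta> \<noteq> 0" using char_poly_split(2) unfolding \<psi>_def .
  have "char_poly A = X ^ m * \<psi>" using char_poly_split(1) unfolding \<psi>_def m_def X_def .
  moreover have "\<psi> \<noteq> 0" using \<psi>0 by auto
  ultimately have ordA: "order \<theta> (char_poly A) = m"
    using \<psi>0 X by (simp add: order_mult order_0I)
  have "mat_delete A i i \<in> carrier_mat (n - 1) (n - 1)" using A by (rule mat_delete_carrier)
  from degree_monic_char_poly[OF this] have \<phi>0: "\<phi> \<noteq> 0" unfolding \<phi>_def by auto
  have "X * \<phi> \<noteq> 0" using \<phi>0 X by simp
  hence q0: "X ^ m * q \<noteq> 0" using g(1) q_def by simp
  have "order \<theta> (X * \<phi>) = 1 + order \<theta> \<phi>" using \<open>X * \<phi> \<noteq> 0\<close> X by (subst order_mult) auto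
  moreover have "order \<theta> (X ^ m * q) = m + order \<theta> q"
    using q0 by (subst order_mult) (auto simp: X)
  ultimately have ord: "1 + order \<theta> \<phi> = m + order \<theta> q" using g(1) q_def by simp
  have C0: "C = 0 \<longleftrightarrow> (\<forall>k<n. b k = \<theta> \<longrightarrow> P i k = 0)"
    unfolding C_def by (subst sum_nonneg_eq_0_iff) auto
  \<comment> \<open>Here \<open>\<phi>\<close> is the deleted polynomial, of order
    \<open>m + order \<theta> q - 1\<close>. Exceeding \<open>m\<close> therefore means
    \<open>order \<theta> q \<ge> 2\<close>; the shift by one comes from the extra factor
    \<open>X\<close>.\<close>
  have "alpha_pole A i \<theta> \<longleftrightarrow> order \<theta> q \<ge> 2"
    unfolding alpha_pole_def rat_pole_def phi_def phi_del_def using ord ordA \<phi>0 \<phi>_def by auto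
  also have "\<dots> \<longleftrightarrow> C = 0 \<and> S = 0"
  proof (cases "C = 0")
    case True
    hence q: "q = X * g" unfolding q_def by simp
    hence "X * g \<noteq> 0" using q0 by auto
    hence "order \<theta> q = 1 + order \<theta> g" unfolding q using X by (subst order_mult) auto
    moreover have "g \<noteq> 0" using \<open>X * g \<noteq> 0\<close> by auto
    ultimately have "order \<theta> q \<ge> 2 \<longleftrightarrow> poly g \<theta> = 0" by (simp add: order_root Suc_le_eq)
    thus ?thesis using True g(2) \<psi>0 by simp
  next
    case False
    hence "poly q \<theta> \<noteq> 0" unfolding q_def using \<psi>0 X by simp
    thus ?thesis using False by (simp add: order_0I)
  qed
  finally show ?thesis unfolding C0 S_def .
qed

text \<open>In coordinates the system reads \<open>(b k - \<theta>) * c k = P i k\<close>. It is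
  solvable iff \<open>P i k = 0\<close> whenever \<open>b k = \<theta>\<close>. The coefficients
  left free do not affect \<open>v i\<close>, which is then minus the second sum in
  \<open>alpha_pole_coords\<close>.\<close>

lemma alpha_pole_iff_solvable:
  assumes i: "i < n"
  shows "alpha_pole A i \<theta> \<longleftrightarrow>
    (\<exists>v. (\<forall>t<n. (\<Sum>j<n. A $$ (t,j) * v j) = \<theta> * v t + (if t = i then 1 else 0)) \<and> v i = 0)"
  (is "_ = (\<exists>v. ?E v \<and> _)")
proof -
  define L where "L = {k. k < n \<and> b k \<noteq> \<theta>}"
  have L: "(\<Sum>k\<in>L. f k) = (\<Sum>k<n. if b k \<noteq> \<theta> then f k else 0)" for f :: "nat \<Rightarrow> real"
    unfolding L_def by (rule sum.mono_neutral_cong_left) auto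
  show ?thesis
  proof
    assume "alpha_pole A i \<theta>"
    hence 1: "\<forall>k<n. b k = \<theta> \<longrightarrow> P i k = 0"
      and 2: "(\<Sum>k\<in>L. P i k * P i k / (\<theta> - b k)) = 0"
      using alpha_pole_coords[OF i, of \<theta>] unfolding L_def by blast+
    define c where "c k = (if b k \<noteq> \<theta> then P i k / (b k - \<theta>) else 0)" for k
    define v where "v j = (\<Sum>k<n. c k * P j k)" for j
    have "(\<Sum>j<n. A $$ (t,j) * v j) = \<theta> * v t + (if t = i then 1 else 0)" if t: "t < n" for t
    proof -
      have "(\<Sum>j<n. A $$ (t,j) * v j) = (\<Sum>k<n. b k * c k * P t k)"
        unfolding v_def using t by (rule mult_coords)
      also have "\<dots> = (\<Sum>k<n. \<theta> * (c k * P t k) + P t k * P i k)"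
        by (intro sum.cong refl) (use 1 in \<open>auto simp: c_def field_simps\<close>)
      also have "\<dots> = \<theta> * v t + (if t = i then 1 else 0)"
        unfolding sum.distrib v_def sum_distrib_left[symmetric] using t i by (simp add: rows_orthonormal)
      finally show ?thesis .
    qed
    moreover have "v i = - (\<Sum>k\<in>L. P i k * P i k / (\<theta> - b k))"
      unfolding v_def L sum_negf[symmetric] c_def
      using minus_divide_right[of "P i k * P i k" "\<theta> - b k" for k]
      by (intro sum.cong refl) auto
    ultimately show "\<exists>v. ?E v \<and> v i = 0" using 2 by (intro exI[of _ v]) simp
  next
    assume "\<exists>v. ?E v \<and> v i = 0"
    then obtain v where v: "?E v" "v i = 0" by blast
    define c where "c k = (\<Sum>j<n. P j k * v j)" for k
    have c: "b k * c k = \<theta> * c k + P i k" if k: "k < n" for k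
    proof -
      have "b k * c k = (\<Sum>t<n. P t k * (\<Sum>j<n. A $$ (t,j) * v j))"
        unfolding c_def using k by (rule coords_mult[symmetric])
      also have "\<dots> = (\<Sum>t<n. \<theta> * (P t k * v t) + (if t = i then 1 else 0) * P t k)"
        using v(1) by (intro sum.cong refl) (auto simp: algebra_simps)
      also have "\<dots> = \<theta> * c k + P i k"
        unfolding sum.distrib c_def sum_distrib_left[symmetric] using i by (simp only: sum_kronecker)
      finally show ?thesis .
    qed
    have 1: "\<forall>k<n. b k = \<theta> \<longrightarrow> P i k = 0" using c by fastforce
    have "(\<Sum>k\<in>L. P i k * P i k / (\<theta> - b k)) = - (\<Sum>k<n. P i k * c k)"
      unfolding L sum_negf[symmetric]
    proof (intro sum.cong refl)
      fix k assume "k \<in> {..<n}"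
      hence k: "k < n" by simp
      show "(if b k \<noteq> \<theta> then P i k * P i k / (\<theta> - b k) else 0) = - (P i k * c k)"
      proof (cases "b k = \<theta>")
        case False
        have "c k = P i k / (b k - \<theta>)" using c[OF k] False by (simp add: field_simps)
        thus ?thesis using minus_divide_right[of "P i k * P i k" "\<theta> - b k"] False by simp
      qed (use 1 k in auto)
    qed
    also have "(\<Sum>k<n. P i k * c k) = v i" unfolding c_def using i by (rule coords_expand)
    finally show "alpha_pole A i \<theta>" using 1 v(2) alpha_pole_coords[OF i, of \<theta>] unfolding L_def by simp
  qed
qed

end

section \<open>Spectral projections of unit vectors\<close>

lemma eigenspace_iff:
  assumes A: "A \<in> carrier_mat n n"
  shows "v \<in> eigenspace A \<theta> \<longleftrightarrow>
    v \<in> carrier_vec n \<and> (\<forall>t<n. (\<Sum>j<n. A $$ (t,j) * v $ j) = \<theta> * v $ t)"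
proof -
  have "A *\<^sub>v v = \<theta> \<cdot>\<^sub>v v \<longleftrightarrow> (\<forall>t<n. (\<Sum>j<n. A $$ (t,j) * v $ j) = \<theta> * v $ t)"
    if "v \<in> carrier_vec n"
    using that A by (auto simp: vec_eq_iff scalar_prod_def lessThan_atLeast0)
  thus ?thesis using A unfolding eigenspace_def by auto
qed

lemma scalar_prod_sum:
  assumes "v \<in> carrier_vec n" "w \<in> carrier_vec n"
  shows "v \<bullet> w = (\<Sum>j<n. v $ j * w $ j)"
  using assms by (simp add: scalar_prod_def lessThan_atLeast0)

lemma scalar_prod_self_zero:
  fixes v :: "real vec"
  assumes v: "v \<in> carrier_vec n" and "v \<bullet> v = 0"
  shows "v = 0\<^sub>v n"
proof -
  have "\<forall>j\<in>{..<n}. v $ j * v $ j = 0"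
    using assms(2) unfolding scalar_prod_sum[OF v v] by (subst (asm) sum_nonneg_eq_0_iff) auto
  thus ?thesis using v by (intro eq_vecI) auto
qed

lemma eigenspace_diff:
  assumes "A \<in> carrier_mat n n" "v \<in> eigenspace A \<theta>" "w \<in> eigenspace A \<theta>"
  shows "v - w \<in> eigenspace A \<theta>"
  using assms by (auto simp: eigenspace_iff[of _ n] algebra_simps sum_subtractf)

lemma eigenspace_smult:
  assumes "A \<in> carrier_mat n n" "v \<in> eigenspace A \<theta>"
  shows "c \<cdot>\<^sub>v v \<in> eigenspace A \<theta>"
  using assms by (auto simp: eigenspace_iff[of _ n] mult.left_commute[of _ c] sum_distrib_left[symmetric])

context
  fixes n :: nat and A :: "real mat" and P :: "nat \<Rightarrow> nat \<Rightarrow> real" and b :: "nat \<Rightarrow> real"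
  assumes A: "A \<in> carrier_mat n n" and ec: "eigen_coords n A P b"
begin

text \<open>The candidate \<open>p\<close> keeps the part of \<open>e_i\<close> along the columns
  with eigenvalue \<open>\<theta>\<close>. That \<open>p\<close> represents evaluation at
  \<open>i\<close> on the eigenspace is the required orthogonality of
  \<open>e_i - p\<close>.\<close>

lemma eig_proj_coords:
  fixes \<theta> :: real
  assumes i: "i < n"
  defines "p \<equiv> vec n (\<lambda>j. \<Sum>k<n. (if b k = \<theta> then P i k else 0) * P j k)"
  shows "eig_proj A \<theta> (unit_vec n i) = p" and "p \<in> eigenspace A \<theta>"
    and "w \<in> eigenspace A \<theta> \<Longrightarrow> p \<bullet> w = w $ i"
proof -
  define c where "c k = (if b k = \<theta> then P i k else 0)" for k
  have p: "p \<in> carrier_vec n" unfolding p_def by simp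
  have pj: "p $ j = (\<Sum>k<n. c k * P j k)" if "j < n" for j
    unfolding p_def c_def using that by simp
  have "(\<Sum>j<n. A $$ (t,j) * p $ j) = \<theta> * p $ t" if t: "t < n" for t
  proof -
    have "(\<Sum>j<n. A $$ (t,j) * p $ j) = (\<Sum>j<n. A $$ (t,j) * (\<Sum>k<n. c k * P j k))"
      by (intro sum.cong) (auto simp: pj)
    also have "\<dots> = (\<Sum>k<n. b k * c k * P t k)" by (rule mult_coords[OF A ec t])
    also have "\<dots> = (\<Sum>k<n. \<theta> * (c k * P t k))" by (intro sum.cong) (auto simp: c_def)
    finally show ?thesis by (simp add: pj[OF t] sum_distrib_left)
  qed
  thus pe: "p \<in> eigenspace A \<theta>" using p by (simp add: eigenspace_iff[OF A])
  show pw: "p \<bullet> w = w $ i" if w: "w \<in> eigenspace A \<theta>" for w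
  proof -
    have wc: "w \<in> carrier_vec n" and we: "\<And>t. t < n \<Longrightarrow> (\<Sum>j<n. A $$ (t,j) * w $ j) = \<theta> * w $ t"
      using w by (auto simp: eigenspace_iff[OF A])
    define d where "d k = (\<Sum>j<n. P j k * w $ j)" for k
    \<comment> \<open>A \<open>\<theta>\<close>-eigenvector has zero coordinate at every other
      eigenvalue, so truncating \<open>P i k\<close> to \<open>c k\<close> loses nothing.\<close>
    have d: "c k * d k = P i k * d k" if k: "k < n" for k
    proof -
      have "b k * d k = (\<Sum>t<n. P t k * (\<Sum>j<n. A $$ (t,j) * w $ j))"
        unfolding d_def by (rule coords_mult[OF A ec k, symmetric])
      also have "\<dots> = (\<Sum>t<n. \<theta> * (P t k * w $ t))" by (intro sum.cong) (auto simp: we)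
      finally have "b k * d k = \<theta> * d k" unfolding d_def by (simp add: sum_distrib_left)
      thus ?thesis by (auto simp: c_def)
    qed
    have "p \<bullet> w = (\<Sum>j<n. (\<Sum>k<n. c k * P j k) * w $ j)"
      unfolding scalar_prod_sum[OF p wc] by (intro sum.cong) (auto simp: pj)
    also have "\<dots> = (\<Sum>j<n. \<Sum>k<n. c k * (P j k * w $ j))"
      by (simp only: sum_distrib_right mult.assoc)
    also have "\<dots> = (\<Sum>k<n. \<Sum>j<n. c k * (P j k * w $ j))" by (rule sum.swap)
    also have "\<dots> = (\<Sum>k<n. P i k * d k)"
      by (intro sum.cong refl) (simp add: d[symmetric], simp add: d_def sum_distrib_left)
    also have "\<dots> = w $ i" unfolding d_def by (rule coords_expand[OF A ec i])
    finally show ?thesis .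
  qed
  have orth: "(unit_vec n i - v) \<bullet> w = w $ i - v \<bullet> w" if "v \<in> carrier_vec n" "w \<in> carrier_vec n" for v w :: "real vec"
    using that i by (subst minus_scalar_prod_distrib[of _ n]) (auto simp: unit_vec_carrier)
  show "eig_proj A \<theta> (unit_vec n i) = p"
    unfolding eig_proj_def
  proof (rule the_equality)
    show "p \<in> eigenspace A \<theta> \<and> (\<forall>w\<in>eigenspace A \<theta>. (unit_vec n i - p) \<bullet> w = 0)"
      using pe pw orth[OF p] by (auto simp: eigenspace_iff[OF A])
  next
    \<comment> \<open>Uniqueness for \<open>THE\<close>: \<open>v - p\<close> lies in the eigenspace
      and is orthogonal to it, hence to itself.\<close>
    fix v assume v: "v \<in> eigenspace A \<theta> \<and> (\<forall>w\<in>eigenspace A \<theta>. (unit_vec n i - v) \<bullet> w = 0)"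
    hence vc: "v \<in> carrier_vec n" by (simp add: eigenspace_iff[OF A])
    let ?w = "v - p"
    have w: "?w \<in> eigenspace A \<theta>" using v pe by (intro eigenspace_diff[OF A]) auto
    have wc: "?w \<in> carrier_vec n" using vc p by simp
    have "?w \<bullet> ?w = v \<bullet> ?w - p \<bullet> ?w" using vc p wc by (intro minus_scalar_prod_distrib)
    also have "\<dots> = 0" using v w orth[OF vc wc] pw[OF w] by simp
    finally have "?w = 0\<^sub>v n" by (rule scalar_prod_self_zero[OF wc])
    hence "?w $ j = 0" if "j < n" for j using that by simp
    thus "v = p" using vc p by (intro eq_vecI) auto
  qed
qed

text \<open>Since \<open>E_\<theta>\<close> is an orthogonal projection, its diagonal entry at
  \<open>i\<close> is the squared norm of \<open>E_\<theta> e_i\<close>; in this form the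
  characteristic polynomials control the norm.\<close>

lemma eig_proj_coords_norm:
  assumes i: "i < n"
  shows "eig_proj A \<theta> (unit_vec n i) $ i = (\<Sum>k | k < n \<and> b k = \<theta>. P i k * P i k)"
proof -
  have "(\<Sum>k | k < n \<and> b k = \<theta>. P i k * P i k) = (\<Sum>k<n. (if b k = \<theta> then P i k else 0) * P i k)"
    by (rule sum.mono_neutral_cong_left) auto
  thus ?thesis unfolding eig_proj_coords(1)[OF i] using i by simp
qed

end

text \<open>Removes the chosen eigenbasis: \<open>E_\<theta> e_i\<close> is the vector of the
  eigenspace that represents evaluation at \<open>i\<close>.\<close>

lemma eig_proj_unit_vec:
  assumes A: "A \<in> carrier_mat n n" and sym: "A\<^sup>T = A" and i: "i < n"
  shows eig_proj_in_eigenspace: "eig_proj A \<theta> (unit_vec n i) \<in> eigenspace A \<theta>"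
    and eig_proj_scalar_prod: "w \<in> eigenspace A \<theta> \<Longrightarrow> eig_proj A \<theta> (unit_vec n i) \<bullet> w = w $ i"
proof -
  obtain P b where ec: "eigen_coords n A P b" using eigen_coords_exist[OF A sym] by blast
  note * = eig_proj_coords[OF A ec i, where \<theta> = \<theta>]
  show "eig_proj A \<theta> (unit_vec n i) \<in> eigenspace A \<theta>"
    and "w \<in> eigenspace A \<theta> \<Longrightarrow> eig_proj A \<theta> (unit_vec n i) \<bullet> w = w $ i"
    unfolding *(1) by (fact *(2), fact *(3))
qed

text \<open>Both fractions have numerator \<open>phi A\<close>, so equality means equal deleted
  polynomials and hence projections of equal norm.\<close>

lemma alpha_eq_imp_eig_proj_eq:
  assumes A: "A \<in> carrier_mat n n" and sym: "A\<^sup>T = A" and ij: "i < n" "j < n"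
    and eq: "alpha A i = alpha A j"
  shows "eig_proj A \<theta> (unit_vec n i) $ i = eig_proj A \<theta> (unit_vec n j) $ j"
proof -
  obtain P b where ec: "eigen_coords n A P b" using eigen_coords_exist[OF A sym] by blast
  \<comment> \<open>Cross-multiplication requires non-zero denominators, because
    \<open>Fract\<close> with denominator \<open>0\<close> is \<open>0\<close>.\<close>
  have del0: "char_poly (mat_delete A t t) \<noteq> 0" for t
    using degree_monic_char_poly[OF mat_delete_carrier[OF A]] by (metis coeff_0 zero_neq_one)
  have A0: "char_poly A \<noteq> 0" using degree_monic_char_poly[OF A] by auto
  have "char_poly A * char_poly (mat_delete A j j) = char_poly A * char_poly (mat_delete A i i)"
    using eq del0 unfolding alpha_def phi_def phi_del_def by (simp add: eq_fract)
  hence "char_poly (mat_delete A i i) = char_poly (mat_delete A j j)" using A0 by simp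
  thus ?thesis unfolding eig_proj_coords_norm[OF A ec ij(1)] eig_proj_coords_norm[OF A ec ij(2)]
    by (rule sum_squares_coords_eq[OF A ec ij])
qed

lemma alpha_pole_iff:
  assumes A: "A \<in> carrier_mat n n" and sym: "A\<^sup>T = A" and i: "i < n"
  shows "alpha_pole A i \<theta> \<longleftrightarrow>
    (\<exists>v. (\<forall>t<n. (\<Sum>j<n. A $$ (t,j) * v j) = \<theta> * v t + (if t = i then 1 else 0)) \<and> v i = 0)"
proof -
  obtain P b where ec: "eigen_coords n A P b" using eigen_coords_exist[OF A sym] by blast
  show ?thesis by (rule alpha_pole_iff_solvable[OF A ec i])
qed

section \<open>Decorated paths\<close>

lemma offs_Suc: "offs Gs (Suc k) = offs Gs k + rg_size (Gs ! k)"
  unfolding offs_def by simp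

lemma offs_mono: "k \<le> l \<Longrightarrow> offs Gs k \<le> offs Gs l"
  by (induction rule: dec_induct) (auto simp: offs_Suc)

lemma offs_block_unique:
  assumes "offs Gs k \<le> a" "a < offs Gs (Suc k)" "offs Gs l \<le> a" "a < offs Gs (Suc l)"
  shows "k = l"
proof (rule ccontr)
  assume "k \<noteq> l"
  hence "Suc k \<le> l \<or> Suc l \<le> k" by auto
  thus False using offs_mono[of "Suc k" l Gs] offs_mono[of "Suc l" k Gs] assms by auto
qed

lemma offs_block_exists: "a < offs Gs m \<Longrightarrow> \<exists>k<m. offs Gs k \<le> a \<and> a < offs Gs (Suc k)"
proof (induction m)
  case 0 thus ?case by (simp add: offs_def)
next
  case (Suc m) thus ?case by (metis less_Suc_eq not_le)
qed

text \<open>What the path edges add to the row of root \<open>k\<close>. The guards drop the missing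
  neighbour at each end; without the first one, truncated subtraction would make vertex
  \<open>0\<close> its own neighbour.\<close>

definition path_nb_sum :: "rgraph list \<Rightarrow> (nat \<Rightarrow> real) \<Rightarrow> nat \<Rightarrow> real" where
  "path_nb_sum Gs u k = (if k > 0 then u (dp_vertex Gs (k - 1)) else 0)
     + (if Suc k < length Gs then u (dp_vertex Gs (Suc k)) else 0)"

lemma adj_mat_transpose:
  assumes "simple_graph m E"
  shows "(Defs.adj_mat m E)\<^sup>T = Defs.adj_mat m E"
  using assms unfolding simple_graph_def Defs.adj_mat_def by (intro eq_matI) auto

lemma rg_mat_carrier: "rg_mat G \<in> carrier_mat (rg_size G) (rg_size G)"
  unfolding rg_mat_def Defs.adj_mat_def by simp

lemma rg_mat_transpose: "rooted_graph G \<Longrightarrow> (rg_mat G)\<^sup>T = rg_mat G"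
  unfolding rooted_graph_def rg_mat_def by (simp add: adj_mat_transpose)

lemma dp_mat_carrier: "dp_mat Gs \<in> carrier_mat (dp_size Gs) (dp_size Gs)"
  unfolding dp_mat_def Defs.adj_mat_def by simp

context
  fixes Gs :: "rgraph list"
  assumes rooted: "\<forall>G \<in> set Gs. rooted_graph G"
begin

lemma root_less: "k < length Gs \<Longrightarrow> rg_root (Gs ! k) < rg_size (Gs ! k)"
  using rooted nth_mem unfolding rooted_graph_def by blast

lemma dp_vertex_block: "k < length Gs \<Longrightarrow> offs Gs k \<le> dp_vertex Gs k \<and> dp_vertex Gs k < offs Gs (Suc k)"
  using root_less by (simp add: dp_vertex_def offs_Suc)

lemma dp_vertex_less: "k < length Gs \<Longrightarrow> dp_vertex Gs k < dp_size Gs"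
  using dp_vertex_block[of k] offs_mono[of "Suc k" "length Gs" Gs] unfolding dp_size_def by simp

text \<open>Each vertex lies in exactly one block, so the index in the first disjunct of
  \<open>dp_adj\<close> must be \<open>k\<close>, and a path edge can leave the block only at its
  root.\<close>

lemma dp_adj_block:
  assumes k: "k < length Gs" and j: "j < rg_size (Gs ! k)"
  shows "dp_adj Gs (offs Gs k + j) c \<longleftrightarrow>
    (offs Gs k \<le> c \<and> c < offs Gs (Suc k) \<and> rg_adj (Gs ! k) j (c - offs Gs k)) \<or>
    (j = rg_root (Gs ! k) \<and> k > 0 \<and> c = dp_vertex Gs (k - 1)) \<or>
    (j = rg_root (Gs ! k) \<and> Suc k < length Gs \<and> c = dp_vertex Gs (Suc k))"
proof -
  let ?a = "offs Gs k + j"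
  have a: "offs Gs k \<le> ?a" "?a < offs Gs (Suc k)" using j by (auto simp: offs_Suc)
  have uni: "l = k" if "offs Gs l \<le> ?a" "?a < offs Gs (Suc l)" for l
    using offs_block_unique[OF that a] .
  have vtx: "?a = dp_vertex Gs l \<longleftrightarrow> l = k \<and> j = rg_root (Gs ! k)" if "l < length Gs" for l
    using uni[of l] dp_vertex_block[OF that] by (auto simp: dp_vertex_def)
  have "(\<exists>l<length Gs. offs Gs l \<le> ?a \<and> ?a < offs Gs (Suc l) \<and> offs Gs l \<le> c \<and> c < offs Gs (Suc l)
        \<and> rg_adj (Gs ! l) (?a - offs Gs l) (c - offs Gs l)) \<longleftrightarrow>
      offs Gs k \<le> c \<and> c < offs Gs (Suc k) \<and> rg_adj (Gs ! k) j (c - offs Gs k)"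
    using uni k a by (metis add_diff_cancel_left')
  moreover have "(\<exists>l. Suc l < length Gs \<and> {?a, c} = {dp_vertex Gs l, dp_vertex Gs (Suc l)}) \<longleftrightarrow>
      (j = rg_root (Gs ! k) \<and> k > 0 \<and> c = dp_vertex Gs (k - 1)) \<or>
      (j = rg_root (Gs ! k) \<and> Suc k < length Gs \<and> c = dp_vertex Gs (Suc k))" (is "?l = ?r")
  proof
    assume ?l
    then obtain l where l: "Suc l < length Gs" "{?a, c} = {dp_vertex Gs l, dp_vertex Gs (Suc l)}" by blast
    from l(2) have "?a = dp_vertex Gs l \<and> c = dp_vertex Gs (Suc l) \<or>
        ?a = dp_vertex Gs (Suc l) \<and> c = dp_vertex Gs l" by (simp only: doubleton_eq_iff)
    thus ?r using vtx[of l] vtx[of "Suc l"] l(1) by auto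
  next
    assume ?r
    thus ?l
    proof (elim disjE conjE)
      assume "j = rg_root (Gs ! k)" "k > 0" "c = dp_vertex Gs (k - 1)"
      thus ?l using k by (intro exI[of _ "k - 1"]) (auto simp: dp_vertex_def)
    next
      assume "j = rg_root (Gs ! k)" "Suc k < length Gs" "c = dp_vertex Gs (Suc k)"
      thus ?l by (intro exI[of _ k]) (auto simp: dp_vertex_def)
    qed
  qed
  ultimately show ?thesis unfolding dp_adj_def by simp
qed

lemma dp_mat_transpose: "(dp_mat Gs)\<^sup>T = dp_mat Gs"
proof -
  have "dp_adj Gs a c" if "dp_adj Gs c a" for a c
    using that[unfolded dp_adj_def]
  proof (elim disjE exE conjE)
    fix k assume k: "k < length Gs" "offs Gs k \<le> c" "c < offs Gs (Suc k)" "offs Gs k \<le> a"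
      "a < offs Gs (Suc k)" "rg_adj (Gs ! k) (c - offs Gs k) (a - offs Gs k)"
    have "simple_graph (rg_size (Gs ! k)) (rg_adj (Gs ! k))"
      using rooted k(1) nth_mem unfolding rooted_graph_def by blast
    moreover have "a - offs Gs k < rg_size (Gs ! k)" "c - offs Gs k < rg_size (Gs ! k)"
      using k by (auto simp: offs_Suc)
    ultimately have "rg_adj (Gs ! k) (a - offs Gs k) (c - offs Gs k)"
      using k(6) unfolding simple_graph_def by blast
    thus ?thesis unfolding dp_adj_def using k by blast
  next
    fix k assume "Suc k < length Gs" "{c, a} = {dp_vertex Gs k, dp_vertex Gs (Suc k)}"
    thus ?thesis unfolding dp_adj_def by (metis insert_commute)
  qed
  hence "dp_adj Gs a c = dp_adj Gs c a" for a c by blast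
  thus ?thesis unfolding dp_mat_def Defs.adj_mat_def by (intro eq_matI) auto
qed

text \<open>The neighbourhood splits into the part inside block \<open>k\<close>, the previous root
  and the next root. These are disjoint, so the 0-1 entry is a sum of three indicators that can be
  summed separately.\<close>

lemma dp_mat_row_sum:
  assumes k: "k < length Gs" and j: "j < rg_size (Gs ! k)"
  shows "(\<Sum>c<dp_size Gs. dp_mat Gs $$ (offs Gs k + j, c) * u c) =
    (\<Sum>l<rg_size (Gs ! k). rg_mat (Gs ! k) $$ (j,l) * u (offs Gs k + l))
    + (if j = rg_root (Gs ! k) then path_nb_sum Gs u k else 0)"
proof -
  let ?a = "offs Gs k + j" and ?B = "{offs Gs k..<offs Gs (Suc k)}" and ?D = "dp_size Gs"
  let ?root = "j = rg_root (Gs ! k)"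
  have D: "offs Gs (Suc k) \<le> ?D" unfolding dp_size_def using k by (intro offs_mono) simp
  have out1: "dp_vertex Gs (k - 1) \<notin> ?B" if "k > 0"
    using dp_vertex_block[of "k - 1"] that k by (cases k) auto
  have out2: "dp_vertex Gs (Suc k) \<notin> ?B" if "Suc k < length Gs"
    using dp_vertex_block[OF that] by simp
  have dist: "dp_vertex Gs (k - 1) \<noteq> dp_vertex Gs (Suc k)" if "k > 0" "Suc k < length Gs"
    using dp_vertex_block[of "k - 1"] dp_vertex_block[OF that(2)] that k
      offs_mono[of k "Suc k" Gs] by (cases k) auto
  have entry: "dp_mat Gs $$ (?a, c) * u c =
      (if c \<in> ?B then rg_mat (Gs ! k) $$ (j, c - offs Gs k) * u c else 0)
      + ((if c = dp_vertex Gs (k - 1) then (if ?root \<and> k > 0 then u c else 0) else 0)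
      + (if c = dp_vertex Gs (Suc k) then (if ?root \<and> Suc k < length Gs then u c else 0) else 0))"
    if c: "c < ?D" for c
  proof -
    have e: "dp_mat Gs $$ (?a, c) = (if dp_adj Gs ?a c then 1 else 0)"
      unfolding dp_mat_def Defs.adj_mat_def using c D j by (simp add: offs_Suc)
    show ?thesis
    proof (cases "c \<in> ?B")
      case True
      hence r: "rg_mat (Gs ! k) $$ (j, c - offs Gs k) = (if rg_adj (Gs ! k) j (c - offs Gs k) then 1 else 0)"
        unfolding rg_mat_def Defs.adj_mat_def using j by (auto simp: offs_Suc)
      have "\<not> (k > 0 \<and> c = dp_vertex Gs (k - 1))" "\<not> (Suc k < length Gs \<and> c = dp_vertex Gs (Suc k))"
        using True out1 out2 by blast+
      thus ?thesis unfolding e r dp_adj_block[OF k j] using True by auto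
    next
      case False
      define X where "X \<longleftrightarrow> ?root \<and> k > 0 \<and> c = dp_vertex Gs (k - 1)"
      define Y where "Y \<longleftrightarrow> ?root \<and> Suc k < length Gs \<and> c = dp_vertex Gs (Suc k)"
      have "dp_adj Gs ?a c \<longleftrightarrow> X \<or> Y"
        unfolding dp_adj_block[OF k j] X_def Y_def using False by (simp only: atLeastLessThan_iff) blast
      moreover have "\<not> (X \<and> Y)" unfolding X_def Y_def using dist by metis
      moreover have "(if c = dp_vertex Gs (k - 1) then (if ?root \<and> k > 0 then u c else 0) else 0)
          = (if X then u c else 0)" unfolding X_def by presburger
      moreover have "(if c = dp_vertex Gs (Suc k) then (if ?root \<and> Suc k < length Gs then u c else 0) else 0)
          = (if Y then u c else 0)" unfolding Y_def by presburger
      ultimately show ?thesis unfolding e using False by (simp only: if_False) simp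
    qed
  qed
  have "(\<Sum>c<?D. if c \<in> ?B then rg_mat (Gs ! k) $$ (j, c - offs Gs k) * u c else 0)
      = (\<Sum>c\<in>?B. rg_mat (Gs ! k) $$ (j, c - offs Gs k) * u c)"
    by (rule sum.mono_neutral_cong_right) (use D in auto)
  also have "\<dots> = (\<Sum>l<rg_size (Gs ! k). rg_mat (Gs ! k) $$ (j,l) * u (offs Gs k + l))"
    by (rule sum.reindex_bij_witness[of _ "\<lambda>l. offs Gs k + l" "\<lambda>c. c - offs Gs k"])
      (auto simp: offs_Suc)
  finally have s1: "(\<Sum>c<?D. if c \<in> ?B then rg_mat (Gs ! k) $$ (j, c - offs Gs k) * u c else 0)
      = (\<Sum>l<rg_size (Gs ! k). rg_mat (Gs ! k) $$ (j,l) * u (offs Gs k + l))" .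
  have s2: "(\<Sum>c<?D. if c = dp_vertex Gs (k - 1) then (if ?root \<and> k > 0 then u c else 0) else 0)
      = (if ?root \<and> k > 0 then u (dp_vertex Gs (k - 1)) else 0)"
    using dp_vertex_less[of "k - 1"] k by (subst sum.delta) auto
  have s3: "(\<Sum>c<?D. if c = dp_vertex Gs (Suc k) then (if ?root \<and> Suc k < length Gs then u c else 0) else 0)
      = (if ?root \<and> Suc k < length Gs then u (dp_vertex Gs (Suc k)) else 0)"
    using dp_vertex_less[of "Suc k"] by (subst sum.delta) auto
  have "(\<Sum>c<?D. dp_mat Gs $$ (?a, c) * u c) = (\<Sum>c<?D.
      (if c \<in> ?B then rg_mat (Gs ! k) $$ (j, c - offs Gs k) * u c else 0)
      + ((if c = dp_vertex Gs (k - 1) then (if ?root \<and> k > 0 then u c else 0) else 0)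
      + (if c = dp_vertex Gs (Suc k) then (if ?root \<and> Suc k < length Gs then u c else 0) else 0)))"
    by (intro sum.cong refl entry) simp
  also have "\<dots> = (\<Sum>l<rg_size (Gs ! k). rg_mat (Gs ! k) $$ (j,l) * u (offs Gs k + l))
      + ((if ?root \<and> k > 0 then u (dp_vertex Gs (k - 1)) else 0)
      + (if ?root \<and> Suc k < length Gs then u (dp_vertex Gs (Suc k)) else 0))"
    unfolding sum.distrib s1 s2 s3 ..
  finally show ?thesis unfolding path_nb_sum_def by auto
qed

text \<open>Block by block, the eigenvector equation is
  \<open>(A(G_k) - \<theta>) v_k = - c e_r\<close> with root \<open>r\<close> and \<open>c\<close>
  the sum over the path neighbours. Up to scaling this is the system in
  \<open>alpha_pole_iff\<close>.\<close>

lemma dp_eigenspace_iff: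
  "v \<in> eigenspace (dp_mat Gs) \<theta> \<longleftrightarrow> v \<in> carrier_vec (dp_size Gs) \<and>
    (\<forall>k<length Gs. \<forall>j<rg_size (Gs ! k).
      (\<Sum>l<rg_size (Gs ! k). rg_mat (Gs ! k) $$ (j,l) * v $ (offs Gs k + l))
      + (if j = rg_root (Gs ! k) then path_nb_sum Gs (($) v) k else 0) = \<theta> * v $ (offs Gs k + j))"
proof -
  have "(\<forall>t<dp_size Gs. Q t) \<longleftrightarrow> (\<forall>k<length Gs. \<forall>j<rg_size (Gs ! k). Q (offs Gs k + j))" for Q
  proof
    assume Q: "\<forall>t<dp_size Gs. Q t"
    show "\<forall>k<length Gs. \<forall>j<rg_size (Gs ! k). Q (offs Gs k + j)"
    proof (intro allI impI)
      fix k j assume k: "k < length Gs" and j: "j < rg_size (Gs ! k)"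
      have "offs Gs (Suc k) \<le> dp_size Gs" unfolding dp_size_def using k by (intro offs_mono) simp
      thus "Q (offs Gs k + j)" using Q j by (simp add: offs_Suc)
    qed
  next
    assume Q: "\<forall>k<length Gs. \<forall>j<rg_size (Gs ! k). Q (offs Gs k + j)"
    show "\<forall>t<dp_size Gs. Q t"
    proof (intro allI impI)
      fix t assume "t < dp_size Gs"
      then obtain k where "k < length Gs" "offs Gs k \<le> t" "t < offs Gs (Suc k)"
        using offs_block_exists unfolding dp_size_def by blast
      thus "Q t" using Q[rule_format, of k "t - offs Gs k"] by (simp add: offs_Suc)
    qed
  qed
  note split = this
  show ?thesis unfolding eigenspace_iff[OF dp_mat_carrier] split by (simp add: dp_mat_row_sum)
qed

end

section \<open>Propagating and cutting eigenvectors along the path\<close>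

context
  fixes Gs :: "rgraph list"
  assumes rooted: "\<forall>G \<in> set Gs. rooted_graph G"
begin

lemma dp_eigenvector_block:
  assumes "v \<in> eigenspace (dp_mat Gs) \<theta>" "k < length Gs" "j < rg_size (Gs ! k)"
  shows "(\<Sum>l<rg_size (Gs ! k). rg_mat (Gs ! k) $$ (j,l) * v $ (offs Gs k + l))
    = \<theta> * v $ (offs Gs k + j) - (if j = rg_root (Gs ! k) then path_nb_sum Gs (($) v) k else 0)"
proof -
  have "(\<Sum>l<rg_size (Gs ! k). rg_mat (Gs ! k) $$ (j,l) * v $ (offs Gs k + l))
      + (if j = rg_root (Gs ! k) then path_nb_sum Gs (($) v) k else 0) = \<theta> * v $ (offs Gs k + j)"
    using assms unfolding dp_eigenspace_iff[OF rooted] by blast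
  thus ?thesis by (simp only: eq_diff_eq)
qed

lemma rg_alpha_pole_iff:
  assumes k: "k < length Gs"
  shows "alpha_pole (rg_mat (Gs ! k)) (rg_root (Gs ! k)) \<theta> \<longleftrightarrow>
    (\<exists>w. (\<forall>j<rg_size (Gs ! k). (\<Sum>l<rg_size (Gs ! k). rg_mat (Gs ! k) $$ (j,l) * w l)
        = \<theta> * w j + (if j = rg_root (Gs ! k) then 1 else 0)) \<and> w (rg_root (Gs ! k)) = 0)"
  using rooted nth_mem[OF k] root_less[OF rooted k]
  by (intro alpha_pole_iff rg_mat_carrier rg_mat_transpose) auto

lemma path_vertices_vanish:
  assumes v: "v \<in> eigenspace (dp_mat Gs) \<theta>"
    and no_pole: "\<And>k. k < length Gs \<Longrightarrow> \<not> alpha_pole (rg_mat (Gs ! k)) (rg_root (Gs ! k)) \<theta>"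
    and v0: "v $ dp_vertex Gs 0 = 0" and k: "k < length Gs"
  shows "v $ dp_vertex Gs k = 0"
  using k
proof (induction k rule: less_induct)
  case (less k)
  show ?case
  proof (cases k)
    case 0 thus ?thesis using v0 by simp
  next
    case (Suc m)
    hence m: "m < length Gs" "Suc m < length Gs" using less.prems by auto
    let ?s = "v $ dp_vertex Gs (Suc m)" and ?G = "Gs ! m"
    have vm: "v $ dp_vertex Gs m = 0" using less.IH[of m] Suc m by simp
    \<comment> \<open>Two preceding zeros are used, at \<open>m\<close> and at \<open>m - 1\<close>,
      hence the strong induction. The next path vertex is then the only one that can
      contribute.\<close>
    have "m > 0 \<Longrightarrow> v $ dp_vertex Gs (m - 1) = 0" using less.IH[of "m - 1"] Suc m by simp
    hence nb: "path_nb_sum Gs (($) v) m = ?s" unfolding path_nb_sum_def using m by simp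
    have eq: "(\<Sum>l<rg_size ?G. rg_mat ?G $$ (j,l) * v $ (offs Gs m + l))
      = \<theta> * v $ (offs Gs m + j) - (if j = rg_root ?G then ?s else 0)" if "j < rg_size ?G" for j
      using dp_eigenvector_block[OF v m(1) that] unfolding nb .
    have "?s = 0"
    proof (rule ccontr)
      assume s: "?s \<noteq> 0"
      \<comment> \<open>The scaling turns the right-hand side \<open>- ?s\<close> at the root into
        \<open>1\<close>, so that \<open>w\<close> witnesses a pole.\<close>
      define w where "w l = (- 1 / ?s) * v $ (offs Gs m + l)" for l
      have "(\<Sum>l<rg_size ?G. rg_mat ?G $$ (j,l) * w l) = \<theta> * w j + (if j = rg_root ?G then 1 else 0)"
        if j: "j < rg_size ?G" for j
      proof -
        have "(\<Sum>l<rg_size ?G. rg_mat ?G $$ (j,l) * w l)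
            = (- 1 / ?s) * (\<Sum>l<rg_size ?G. rg_mat ?G $$ (j,l) * v $ (offs Gs m + l))"
          unfolding w_def by (simp only: sum_distrib_left mult_ac)
        thus ?thesis unfolding eq[OF j] w_def using s by (simp add: field_simps)
      qed
      moreover have "w (rg_root ?G) = 0" using vm unfolding w_def dp_vertex_def by simp
      ultimately have "alpha_pole (rg_mat ?G) (rg_root ?G) \<theta>"
        unfolding rg_alpha_pole_iff[OF m(1)] by blast
      with no_pole[OF m(1)] show False by blast
    qed
    thus ?thesis using Suc by simp
  qed
qed

text \<open>By symmetry of the block, pairing \<open>w\<close> with
  \<open>(A(G_k) - \<theta>) u\<close> gives the root entry of \<open>u\<close>. The same pairing is
  zero by the eigenvector equation, whose path term meets \<open>w\<close> only at the root, where
  \<open>w\<close> vanishes.\<close>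

lemma pole_imp_path_vertex_zero:
  assumes v: "v \<in> eigenspace (dp_mat Gs) \<theta>" and k: "k < length Gs"
    and w: "\<And>j. j < rg_size (Gs ! k) \<Longrightarrow> (\<Sum>l<rg_size (Gs ! k). rg_mat (Gs ! k) $$ (j,l) * w l)
        = \<theta> * w j + (if j = rg_root (Gs ! k) then 1 else 0)"
    and w0: "w (rg_root (Gs ! k)) = 0"
  shows "v $ dp_vertex Gs k = 0"
proof -
  let ?M = "rg_mat (Gs ! k)" and ?r = "rg_root (Gs ! k)" and ?N = "rg_size (Gs ! k)"
  define u where "u l = v $ (offs Gs k + l)" for l
  have r: "?r < ?N" by (rule root_less[OF rooted k])
  have M: "?M $$ (i,j) = ?M $$ (j,i)" if "i < ?N" "j < ?N" for i j
    using rg_mat_transpose[of "Gs ! k"] rooted nth_mem[OF k] that rg_mat_carrier[of "Gs ! k"]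
    by (metis carrier_matD index_transpose_mat(1))
  have u: "(\<Sum>l<?N. ?M $$ (j,l) * u l) = \<theta> * u j - (if j = ?r then path_nb_sum Gs (($) v) k else 0)"
    if "j < ?N" for j
    using dp_eigenvector_block[OF v k that] unfolding u_def .
  have "(\<Sum>j<?N. w j * (\<Sum>l<?N. ?M $$ (j,l) * u l)) = (\<Sum>j<?N. \<theta> * (w j * u j))"
    by (intro sum.cong refl) (auto simp: u w0)
  moreover have "(\<Sum>j<?N. w j * (\<Sum>l<?N. ?M $$ (j,l) * u l)) = (\<Sum>l<?N. u l * (\<Sum>j<?N. ?M $$ (l,j) * w j))"
    unfolding sum_distrib_left by (subst sum.swap, intro sum.cong refl) (auto simp: M mult_ac)
  moreover have "(\<Sum>l<?N. u l * (\<Sum>j<?N. ?M $$ (l,j) * w j))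
      = (\<Sum>l<?N. \<theta> * (w l * u l)) + (\<Sum>l<?N. (if l = ?r then 1 else 0) * u l)"
    unfolding sum.distrib[symmetric] by (intro sum.cong refl) (simp only: w lessThan_iff, simp add: algebra_simps)
  ultimately have "(\<Sum>l<?N. (if l = ?r then 1 else 0) * u l) = 0" by simp
  thus ?thesis using r unfolding u_def dp_vertex_def by (simp only: sum_kronecker)
qed

text \<open>Any multiple of the pole witness has root entry zero, so it is invisible to the
  neighbouring blocks, while it can absorb whatever enters block \<open>k\<close> from the
  left.\<close>

lemma eigenvector_cut_at_pole:
  assumes v: "v \<in> eigenspace (dp_mat Gs) \<theta>" and k: "k < length Gs" "k > 0"
    and pole: "alpha_pole (rg_mat (Gs ! k)) (rg_root (Gs ! k)) \<theta>"
  shows "\<exists>u \<in> eigenspace (dp_mat Gs) \<theta>.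
    \<forall>m<length Gs. u $ dp_vertex Gs m = (if m < k then v $ dp_vertex Gs m else 0)"
proof -
  obtain w where w: "\<And>j. j < rg_size (Gs ! k) \<Longrightarrow> (\<Sum>l<rg_size (Gs ! k). rg_mat (Gs ! k) $$ (j,l) * w l)
        = \<theta> * w j + (if j = rg_root (Gs ! k) then 1 else 0)" and w0: "w (rg_root (Gs ! k)) = 0"
    using pole unfolding rg_alpha_pole_iff[OF k(1)] by blast
  have vk: "v $ dp_vertex Gs k = 0" by (rule pole_imp_path_vertex_zero[OF v k(1) w w0])
  \<comment> \<open>In block \<open>k\<close>, \<open>s * w\<close> leaves an excess
    \<open>s\<close> at the root. It has to cancel the contribution of vertex \<open>k - 1\<close>,
    the only non-zero path neighbour after the cut.\<close>
  define s where "s = - v $ dp_vertex Gs (k - 1)"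
  define u where "u = vec (dp_size Gs) (\<lambda>c. if c < offs Gs k then v $ c
      else if c < offs Gs (Suc k) then s * w (c - offs Gs k) else 0)"
  have size: "offs Gs m + l < dp_size Gs" if "m < length Gs" "l < rg_size (Gs ! m)" for m l
    using that offs_mono[of "Suc m" "length Gs" Gs] unfolding dp_size_def by (simp add: offs_Suc)
  have ub: "u $ (offs Gs m + l) = (if m < k then v $ (offs Gs m + l) else if m = k then s * w l else 0)"
    if "m < length Gs" "l < rg_size (Gs ! m)" for m l
  proof (cases m k rule: linorder_cases)
    case less
    hence "offs Gs m + l < offs Gs k" using that offs_mono[of "Suc m" k Gs] by (simp add: offs_Suc)
    thus ?thesis unfolding u_def using less size[OF that] by simp
  next
    case equal
    thus ?thesis unfolding u_def using size[OF that] that by (simp add: offs_Suc)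
  next
    case greater
    hence "offs Gs (Suc k) \<le> offs Gs m + l" using offs_mono[of "Suc k" m Gs] by simp
    moreover have "offs Gs k \<le> offs Gs (Suc k)" by (rule offs_mono) simp
    ultimately show ?thesis unfolding u_def using greater size[OF that] by simp
  qed
  have uv: "u $ dp_vertex Gs m = (if m < k then v $ dp_vertex Gs m else 0)" if "m < length Gs" for m
    using ub[OF that root_less[OF rooted that]] w0 unfolding dp_vertex_def by simp
  have "(\<Sum>l<rg_size (Gs ! m). rg_mat (Gs ! m) $$ (j,l) * u $ (offs Gs m + l))
      + (if j = rg_root (Gs ! m) then path_nb_sum Gs (($) u) m else 0) = \<theta> * u $ (offs Gs m + j)"
    if m: "m < length Gs" and j: "j < rg_size (Gs ! m)" for m j
  proof (cases m k rule: linorder_cases)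
    case less
    \<comment> \<open>Only block \<open>k - 1\<close> borders the cut; there \<open>u\<close>
      vanishes at vertex \<open>k\<close> by construction and \<open>v\<close> by
      \<open>vk\<close>.\<close>
    have "path_nb_sum Gs (($) u) m = path_nb_sum Gs (($) v) m"
      unfolding path_nb_sum_def using less uv m vk by (cases "Suc m = k") auto
    moreover have "(\<Sum>l<rg_size (Gs ! m). rg_mat (Gs ! m) $$ (j,l) * u $ (offs Gs m + l))
        = (\<Sum>l<rg_size (Gs ! m). rg_mat (Gs ! m) $$ (j,l) * v $ (offs Gs m + l))"
      by (intro sum.cong refl) (use ub[OF m] less in auto)
    moreover have "u $ (offs Gs m + j) = v $ (offs Gs m + j)" using ub[OF m j] less by simp
    ultimately show ?thesis using dp_eigenvector_block[OF v m j] by (simp only: diff_add_cancel)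
  next
    case equal
    have nb: "path_nb_sum Gs (($) u) m = - s"
      unfolding path_nb_sum_def s_def using equal uv[of "k - 1"] uv[of "Suc k"] k by auto
    have "(\<Sum>l<rg_size (Gs ! m). rg_mat (Gs ! m) $$ (j,l) * u $ (offs Gs m + l))
        = (\<Sum>l<rg_size (Gs ! m). s * (rg_mat (Gs ! m) $$ (j,l) * w l))"
      by (intro sum.cong refl) (use ub[OF m] equal in auto)
    also have "\<dots> = s * (\<theta> * w j + (if j = rg_root (Gs ! k) then 1 else 0))"
      unfolding sum_distrib_left[symmetric] using w[of j] j equal by simp
    finally show ?thesis unfolding nb using ub[OF m j] equal by (simp add: algebra_simps)
  next
    case greater
    \<comment> \<open>This includes \<open>m = Suc k\<close>, whose left neighbour has entry
      \<open>s * w (rg_root (Gs ! k)) = 0\<close>.\<close>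
    have "path_nb_sum Gs (($) u) m = 0"
      unfolding path_nb_sum_def using greater uv m by auto
    moreover have "u $ (offs Gs m + l) = 0" if "l < rg_size (Gs ! m)" for l
      using ub[OF m that] greater by simp
    ultimately show ?thesis using j by simp
  qed
  moreover have "u \<in> carrier_vec (dp_size Gs)" unfolding u_def by simp
  ultimately have "u \<in> eigenspace (dp_mat Gs) \<theta>" unfolding dp_eigenspace_iff[OF rooted] by blast
  thus ?thesis using uv by blast
qed

end

text \<open>The projections represent evaluation at \<open>i\<close> and \<open>j\<close> on the
  eigenspace. By \<open>vanish\<close> the kernel of the first lies in that of the second, so the
  projections are parallel; equal norms leave only the sign.\<close>

lemma eig_proj_eq_or_neg:
  assumes A: "A \<in> carrier_mat n n" and sym: "A\<^sup>T = A" and ij: "i < n" "j < n"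
    and eq: "alpha A i = alpha A j"
    and vanish: "\<And>u. u \<in> eigenspace A \<theta> \<Longrightarrow> u $ i = 0 \<Longrightarrow> u $ j = 0"
  shows "eig_proj A \<theta> (unit_vec n i) = eig_proj A \<theta> (unit_vec n j) \<or>
    eig_proj A \<theta> (unit_vec n i) = - eig_proj A \<theta> (unit_vec n j)"
proof -
  define p q where "p = eig_proj A \<theta> (unit_vec n i)" and "q = eig_proj A \<theta> (unit_vec n j)"
  define s where "s = p $ i"
  have p: "p \<in> eigenspace A \<theta>" and pw: "w \<in> eigenspace A \<theta> \<Longrightarrow> p \<bullet> w = w $ i" for w
    using eig_proj_unit_vec[OF A sym ij(1)] unfolding p_def by auto
  have q: "q \<in> eigenspace A \<theta>" and qw: "w \<in> eigenspace A \<theta> \<Longrightarrow> q \<bullet> w = w $ j" for w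
    using eig_proj_unit_vec[OF A sym ij(2)] unfolding q_def by auto
  have pc: "p \<in> carrier_vec n" and qc: "q \<in> carrier_vec n"
    using p q by (auto simp: eigenspace_iff[OF A])
  have pp: "p \<bullet> p = s" using pw[OF p] s_def by simp
  have qq: "q \<bullet> q = s" using qw[OF q] alpha_eq_imp_eig_proj_eq[OF A sym ij eq, of \<theta>]
    unfolding s_def p_def q_def by simp
  define t where "t = q $ i"
  have pq: "p \<bullet> q = t" using pw[OF q] t_def by simp
  \<comment> \<open>The component of \<open>q\<close> orthogonal to \<open>p\<close>, multiplied by
    \<open>s = p \<bullet> p\<close> to avoid dividing by zero. It vanishes at \<open>i\<close>,
    hence at \<open>j\<close>, so it is orthogonal to \<open>p\<close> and \<open>q\<close> and thus
    to itself.\<close>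
  define u where "u = s \<cdot>\<^sub>v q - t \<cdot>\<^sub>v p"
  have u: "u \<in> eigenspace A \<theta>" unfolding u_def
    by (intro eigenspace_diff[OF A] eigenspace_smult[OF A] p q)
  have uc: "u \<in> carrier_vec n" using pc qc unfolding u_def by simp
  have ui: "u $ i = 0" unfolding u_def using ij pc qc by (simp add: s_def t_def)
  have "u \<bullet> u = s * (q \<bullet> u) - t * (p \<bullet> u)"
    unfolding u_def[THEN arg_cong, of "\<lambda>x. x \<bullet> u"] using pc qc uc
    by (subst minus_scalar_prod_distrib[of _ n]) auto
  also have "\<dots> = 0" using qw[OF u] pw[OF u] ui vanish[OF u ui] by simp
  finally have u0: "u = 0\<^sub>v n" by (rule scalar_prod_self_zero[OF uc])
  have lin: "s * q $ l = t * p $ l" if "l < n" for l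
    using arg_cong[OF u0, of "\<lambda>x. x $ l"] that pc qc unfolding u_def by simp
  show ?thesis
  proof (cases "s = 0")
    case True
    hence "p = 0\<^sub>v n" "q = 0\<^sub>v n" using scalar_prod_self_zero pc qc pp qq by auto
    thus ?thesis unfolding p_def q_def by simp
  next
    case False
    \<comment> \<open>Pairing \<open>lin\<close> with \<open>q\<close> turns the equality of norms
      into \<open>s * s = t * t\<close>.\<close>
    have "s * (q \<bullet> q) = t * (p \<bullet> q)"
      unfolding scalar_prod_sum[OF pc qc] scalar_prod_sum[OF qc qc] sum_distrib_left
      using lin by (intro sum.cong refl) (simp add: mult.assoc[symmetric])
    hence "s * s = t * t" using qq pq by simp
    hence "t = s \<or> t = - s" by (auto simp: square_eq_iff)
    hence "(\<forall>l<n. q $ l = p $ l) \<or> (\<forall>l<n. q $ l = - p $ l)"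
      using lin False by (metis minus_mult_commute mult_left_cancel mult_minus_left)
    hence "p = q \<or> p = - q" using pc qc by (auto simp: vec_eq_iff)
    thus ?thesis unfolding p_def q_def .
  qed
qed

theorem theorem7:
  fixes Gs :: "rgraph list" and n :: nat
  assumes "length Gs = n" and "n \<ge> 1"
    and "\<forall>G \<in> set Gs. rooted_graph G"
    and "alpha (dp_mat Gs) (dp_vertex Gs 0) = alpha (dp_mat Gs) (dp_vertex Gs (n - 1))"
  shows "strongly_cospectral (dp_mat Gs) (dp_vertex Gs 0) (dp_vertex Gs (n - 1)) \<longleftrightarrow>
    (\<forall>\<theta> \<in> eig_support (dp_mat Gs) (dp_vertex Gs 0). \<forall>k<n.
        \<not> alpha_pole (rg_mat (Gs ! k)) (rg_root (Gs ! k)) \<theta>)"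
proof -
  note rooted = assms(3)
  let ?A = "dp_mat Gs" and ?a = "dp_vertex Gs 0" and ?b = "dp_vertex Gs (n - 1)" and ?D = "dp_size Gs"
  note A = dp_mat_carrier[of Gs] and sym = dp_mat_transpose[OF rooted]
  have dim: "dim_row ?A = ?D" using A by simp
  have a: "?a < ?D" and b: "?b < ?D" using dp_vertex_less[OF rooted] assms(1,2) by auto
  define p q where "p \<theta> = eig_proj ?A \<theta> (unit_vec ?D ?a)" and "q \<theta> = eig_proj ?A \<theta> (unit_vec ?D ?b)" for \<theta>
  have p: "p \<theta> \<in> eigenspace ?A \<theta>" and pw: "w \<in> eigenspace ?A \<theta> \<Longrightarrow> p \<theta> \<bullet> w = w $ ?a" for w \<theta>
    using eig_proj_unit_vec[OF A sym a] unfolding p_def by auto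
  have qw: "w \<in> eigenspace ?A \<theta> \<Longrightarrow> q \<theta> \<bullet> w = w $ ?b" for w \<theta>
    using eig_proj_unit_vec[OF A sym b] unfolding q_def by auto
  have qe: "q \<theta> \<in> eigenspace ?A \<theta>" for \<theta>
    using eig_proj_unit_vec[OF A sym b] unfolding q_def by auto
  have carr: "w \<in> carrier_vec ?D" if "w \<in> eigenspace ?A \<theta>" for w \<theta>
    using that by (simp add: eigenspace_iff[OF A])
  show ?thesis
  proof
    assume sc: "strongly_cospectral ?A ?a ?b"
    show "\<forall>\<theta>\<in>eig_support ?A ?a. \<forall>k<n. \<not> alpha_pole (rg_mat (Gs ! k)) (rg_root (Gs ! k)) \<theta>"
    proof (intro ballI allI impI notI)
      fix \<theta> k
      assume \<theta>: "\<theta> \<in> eig_support ?A ?a" and k: "k < n"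
        and pole: "alpha_pole (rg_mat (Gs ! k)) (rg_root (Gs ! k)) \<theta>"
      have ev: "eigenvalue ?A \<theta>" and p0: "p \<theta> \<noteq> 0\<^sub>v ?D"
        using \<theta> unfolding eig_support_def dim p_def by auto
      have "p \<theta> \<bullet> p \<theta> \<noteq> 0" using p0 scalar_prod_self_zero[OF carr[OF p]] by blast
      hence pa: "p \<theta> $ ?a \<noteq> 0" using pw[OF p] by simp
      have pq: "p \<theta> = q \<theta> \<or> p \<theta> = - q \<theta>"
        using sc ev unfolding strongly_cospectral_def dim p_def q_def by blast
      \<comment> \<open>If the projections agree up to sign, every eigenvector has entries of equal
        absolute value at the two ends.\<close>
      have ends: "u $ ?b \<noteq> 0" if u: "u \<in> eigenspace ?A \<theta>" and ua: "u $ ?a \<noteq> 0" for u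
      proof -
        have "p \<theta> \<bullet> u = q \<theta> \<bullet> u \<or> p \<theta> \<bullet> u = - (q \<theta> \<bullet> u)"
          using pq carr[OF u] carr[OF qe] by (auto simp: scalar_prod_uminus_left)
        thus ?thesis using ua pw[OF u] qw[OF u] by auto
      qed
      have kl: "k < length Gs" using k assms(1) by simp
      from pole obtain w where w: "\<And>j. j < rg_size (Gs ! k) \<Longrightarrow>
          (\<Sum>l<rg_size (Gs ! k). rg_mat (Gs ! k) $$ (j,l) * w l)
          = \<theta> * w j + (if j = rg_root (Gs ! k) then 1 else 0)" and w0: "w (rg_root (Gs ! k)) = 0"
        unfolding rg_alpha_pole_iff[OF rooted kl] by blast
      have "p \<theta> $ dp_vertex Gs k = 0" by (rule pole_imp_path_vertex_zero[OF rooted p kl w w0])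
      \<comment> \<open>The pole cannot sit at the first block, where \<open>p \<theta>\<close> is
        non-zero. Cutting \<open>p \<theta>\<close> at block \<open>k\<close> therefore keeps the
        first entry but kills the last one, contradicting \<open>ends\<close>.\<close>
      hence "k > 0" using pa by (cases k) auto
      then obtain u where u: "u \<in> eigenspace ?A \<theta>"
        "\<forall>m<length Gs. u $ dp_vertex Gs m = (if m < k then p \<theta> $ dp_vertex Gs m else 0)"
        using eigenvector_cut_at_pole[OF rooted p kl _ pole] by blast
      have "u $ ?a \<noteq> 0" using u(2) pa \<open>k > 0\<close> assms(1,2) by auto
      moreover have "u $ ?b = 0" using u(2) k assms(1,2) by auto
      ultimately show False using ends[OF u(1)] by blast
    qed
  next
    assume np: "\<forall>\<theta>\<in>eig_support ?A ?a. \<forall>k<n. \<not> alpha_pole (rg_mat (Gs ! k)) (rg_root (Gs ! k)) \<theta>"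
    show "strongly_cospectral ?A ?a ?b"
      unfolding strongly_cospectral_def dim
    proof (intro allI impI)
      fix \<theta> assume ev: "eigenvalue ?A \<theta>"
      show "eig_proj ?A \<theta> (unit_vec ?D ?a) = eig_proj ?A \<theta> (unit_vec ?D ?b) \<or>
        eig_proj ?A \<theta> (unit_vec ?D ?a) = - eig_proj ?A \<theta> (unit_vec ?D ?b)"
      proof (cases "\<theta> \<in> eig_support ?A ?a")
        case True
        have "u $ ?b = 0" if "u \<in> eigenspace ?A \<theta>" "u $ ?a = 0" for u
          using path_vertices_vanish[OF rooted that(1) _ that(2), of "n - 1"] np True assms(1,2) by auto
        thus ?thesis by (intro eig_proj_eq_or_neg[OF A sym a b assms(4)])
      next
        case False
        \<comment> \<open>Outside the support of the first vertex its projection is zero, and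
          equality of norms forces the other projection to be zero as well.\<close>
        hence p0: "p \<theta> = 0\<^sub>v ?D" using ev unfolding eig_support_def dim p_def by simp
        have "q \<theta> \<bullet> q \<theta> = p \<theta> $ ?a"
          using qw[OF qe] alpha_eq_imp_eig_proj_eq[OF A sym a b assms(4), of \<theta>]
          unfolding p_def q_def by simp
        hence "q \<theta> = 0\<^sub>v ?D" using p0 a by (intro scalar_prod_self_zero[OF carr[OF qe]]) simp
        thus ?thesis using p0 unfolding p_def q_def by simp
      qed
    qed
  qed
qed

end
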